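(* Let $\lambda_1,\lambda_2\in\mathbb R$, $\Delta t>0$, $t_k=k\Delta t$, and let $\mathbb U_k=(\mathbf E_k^\top,\mathbf H_k^\top)^\top$, $k=0,1,2,\dots$, be the numerical solution of the linear stochastic Maxwell's equation with additive noise $$\mathrm d\mathbf E-\nabla\times\mathbf H\,\mathrm dt=\lambda_1\mathbf e\,\mathrm dW,\qquad \mathrm d\mathbf H+\nabla\times\mathbf E\,\mathrm dt=\lambda_2\mathbf e\,\mathrm dW,\qquad \mathbf e=(1,1,1)^\top,$$ given by the exponential integrator $\mathbb U_0=\mathbb U(0)$, $\mathbb U_{k+1}=\mathbf S(\Delta t)\mathbb U_k+\mathbf S(\Delta t)\mathbb G\,\Delta W_k$. Let $\Phi(t_k)=\int_{\mathcal O}(\|\mathbf E_k\|^2+\|\mathbf H_k\|^2)\,\mathrm d\mathbf x$ denote the numerical energy and $K=3(\lambda_1^2+\lambda_2^2)\mathrm{Tr}(Q)$. Then the numerical solution satisfies the trace formula (the same as the one satisfied by the exact solution) $$\mathbb E[\Phi(t_k)]=\mathbb E[\Phi(0)]+Kt_k\qquad\text{for all } k=1,2,\ldots$$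
   Context: $\mathcal O\subset\mathbb R^3$ is a bounded, simply connected domain with smooth boundary and unit outward normal $\mathbf n$; $\epsilon=\mu=1$. $V=L^2(\mathcal O)^3\times L^2(\mathcal O)^3$ with its usual $L^2$ inner product; $\|\cdot\|$ in the definition of $\Phi$ is the Euclidean norm on $\mathbb R^3$. $H(\mathrm{curl},\mathcal O)=\{\mathbf v\in L^2(\mathcal O)^3:\nabla\times\mathbf v\in L^2(\mathcal O)^3\}$, $H_0(\mathrm{curl},\mathcal O)=\{\mathbf v\in H(\mathrm{curl},\mathcal O):\mathbf n\times\mathbf v|_{\partial\mathcal O}=0\}$. The Maxwell operator $A(\mathbf E,\mathbf H)=(\nabla\times\mathbf H,-\nabla\times\mathbf E)$ with domain $D(A)=H_0(\mathrm{curl},\mathcal O)\times H(\mathrm{curl},\mathcal O)$ (perfect conductor boundary condition) is skew-adjoint and generates the unitary $C_0$-group $\mathbf S(t)=e^{tA}$ on $V$; $\|v\|_{D(A)}^2=\|v\|_V^2+\|Av\|_V^2$. $U=L^2(\mathcal O;\mathbb R)$; $Q$ is a symmetric nonnegative trace class operator on $U$ with orthonormal eigenbasis $(e_k)_{k\ge1}$, $Qe_k=\eta_ke_k$, and $W(t)=\sum_kQ^{1/2}e_k\beta_k(t)$ is a $Q$-Wiener process, $(\beta_k)$ being independent standard real Brownian motions on a stochastic basis $(\Omega,\mathscr F,\{\mathscr F_t\}_{t\ge0},\mathbb P)$. $\Delta W_k=W(t_{k+1})-W(t_k)$. $\mathbb G=(\lambda_1,\lambda_1,\lambda_1,\lambda_2,\lambda_2,\lambda_2)^\top$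 acts by $\mathbb Gu=(\lambda_1u,\lambda_1u,\lambda_1u,\lambda_2u,\lambda_2u,\lambda_2u)^\top\in V$ for $u\in U$. The initial value $\mathbb U(0)$ is a $D(A)$-valued $\mathscr F_0$-measurable random variable with $\mathbb E[\|\mathbb U(0)\|_{D(A)}^p]<\infty$ for all $p\ge1$. *)

theory Defs
  imports "HOL-Probability.Probability"
begin

section \<open>Square integrable fields as a real inner product space\<close>

definition square_integrable :: "(real^3 \<Rightarrow> 'a::euclidean_space) \<Rightarrow> bool" where
  "square_integrable f \<longleftrightarrow>
     f \<in> borel_measurable lborel \<and> integrable lborel (\<lambda>x. (norm (f x))\<^sup>2)"

lemma square_integrable_inner:
  assumes "square_integrable f" "square_integrable g"
  shows "integrable lborel (\<lambda>x. f x \<bullet> g x)"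
proof (rule Bochner_Integration.integrable_bound)
  show "integrable lborel (\<lambda>x. (norm (f x))\<^sup>2 + (norm (g x))\<^sup>2)"
    using assms by (simp add: square_integrable_def)
  have "\<bar>f x \<bullet> g x\<bar> \<le> (norm (f x))\<^sup>2 + (norm (g x))\<^sup>2" for x
  proof -
    have "\<bar>f x \<bullet> g x\<bar> \<le> norm (f x) * norm (g x)" by (rule Cauchy_Schwarz_ineq2)
    also have "\<dots> \<le> (norm (f x))\<^sup>2 + (norm (g x))\<^sup>2"
      using sum_squares_bound[of "norm (f x)" "norm (g x)"]
        mult_nonneg_nonneg[OF norm_ge_zero[of "f x"] norm_ge_zero[of "g x"]]
      by linarith
    finally show ?thesis .
  qed
  then show "AE x in lborel. norm (f x \<bullet> g x) \<le> norm ((norm (f x))\<^sup>2 + (norm (g x))\<^sup>2)"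
    by simp
qed (use assms in \<open>auto simp: square_integrable_def\<close>)

lemma square_integrable_zero: "square_integrable (\<lambda>x. 0)"
  by (simp add: square_integrable_def)

lemma square_integrable_scaleR:
  "square_integrable f \<Longrightarrow> square_integrable (\<lambda>x. c *\<^sub>R f x)"
  by (auto simp: square_integrable_def power_mult_distrib)

lemma square_integrable_add:
  assumes "square_integrable f" "square_integrable g"
  shows "square_integrable (\<lambda>x. f x + g x)"
proof -
  have "(norm (f x + g x))\<^sup>2 = (norm (f x))\<^sup>2 + 2 * (f x \<bullet> g x) + (norm (g x))\<^sup>2" for x
    by (simp add: power2_norm_eq_inner inner_simps inner_commute)
  then show ?thesis
    using assms square_integrable_inner[OF assms] by (auto simp: square_integrable_def)
qed

lemma square_integrable_minus: "square_integrable f \<Longrightarrow> square_integrable (\<lambda>x. - f x)"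
  by (auto simp: square_integrable_def)

lemma square_integrable_diff:
  "square_integrable f \<Longrightarrow> square_integrable g \<Longrightarrow> square_integrable (\<lambda>x. f x - g x)"
  using square_integrable_add[of f "\<lambda>x. - g x"] square_integrable_minus[of g] by simp

quotient_type (overloaded) 'a L2 = "real^3 \<Rightarrow> 'a::euclidean_space" / partial:
  "\<lambda>f g. square_integrable f \<and> square_integrable g \<and> (AE x in lborel. f x = g x)"
  morphisms rep_L2 abs_L2
proof (rule part_equivpI)
  show "\<exists>f. square_integrable f \<and> square_integrable f \<and> (AE x in lborel. f x = (f x::'a))"
    using square_integrable_zero by (intro exI[of _ "\<lambda>x. 0"]) simp
  show "symp (\<lambda>f g. square_integrable f \<and> square_integrable g \<and> (AE x in lborel. f x = (g x::'a)))"
    by (auto simp: symp_def elim: eventually_mono)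
  show "transp (\<lambda>f g. square_integrable f \<and> square_integrable g \<and> (AE x in lborel. f x = (g x::'a)))"
    by (rule transpI) (auto elim: eventually_elim2)
qed

instantiation L2 :: (euclidean_space) real_inner
begin

lift_definition zero_L2 :: "'a L2" is "\<lambda>x. 0"
  by (simp add: square_integrable_zero)

lift_definition plus_L2 :: "'a L2 \<Rightarrow> 'a L2 \<Rightarrow> 'a L2" is "\<lambda>f g x. f x + g x"
  by (auto intro: square_integrable_add elim: eventually_elim2)

lift_definition uminus_L2 :: "'a L2 \<Rightarrow> 'a L2" is "\<lambda>f x. - f x"
  by (auto intro: square_integrable_minus elim: eventually_mono)

lift_definition minus_L2 :: "'a L2 \<Rightarrow> 'a L2 \<Rightarrow> 'a L2" is "\<lambda>f g x. f x - g x"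
  by (auto intro: square_integrable_diff elim: eventually_elim2)

lift_definition scaleR_L2 :: "real \<Rightarrow> 'a L2 \<Rightarrow> 'a L2" is "\<lambda>c f x. c *\<^sub>R f x"
  by (auto intro: square_integrable_scaleR elim: eventually_mono)

lift_definition inner_L2 :: "'a L2 \<Rightarrow> 'a L2 \<Rightarrow> real" is "\<lambda>f g. \<integral>x. f x \<bullet> g x \<partial>lborel"
  by (rule integral_cong_AE)
    (auto simp: square_integrable_def elim: eventually_elim2 intro: borel_measurable_inner)

definition norm_L2 :: "'a L2 \<Rightarrow> real" where "norm_L2 u = sqrt (u \<bullet> u)"

definition sgn_L2 :: "'a L2 \<Rightarrow> 'a L2" where "sgn_L2 u = scaleR (inverse (norm u)) u"

definition dist_L2 :: "'a L2 \<Rightarrow> 'a L2 \<Rightarrow> real" where "dist_L2 u v = norm (u - v)"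

definition uniformity_L2 :: "('a L2 \<times> 'a L2) filter" where
  "uniformity_L2 = (INF e\<in>{0<..}. principal {(u, v). dist u v < e})"

definition open_L2 :: "'a L2 set \<Rightarrow> bool" where
  "open_L2 S = (\<forall>u\<in>S. \<forall>\<^sub>F (u', v) in uniformity. u' = u \<longrightarrow> v \<in> S)"

instance
proof
  fix u v w :: "'a L2" and a b :: real
  show "u + v + w = u + (v + w)"
    by transfer (simp add: square_integrable_add add.assoc)
  show "u + v = v + u"
    by transfer (simp add: square_integrable_add add.commute)
  show "0 + u = u"
    by transfer simp
  show "- u + u = 0"
    by transfer (simp add: square_integrable_zero)
  show "u - v = u + - v"
    by transfer (simp add: square_integrable_diff)
  show "a *\<^sub>R (u + v) = a *\<^sub>R u + a *\<^sub>R v"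
    by transfer (simp add: square_integrable_add square_integrable_scaleR scaleR_right_distrib)
  show "(a + b) *\<^sub>R u = a *\<^sub>R u + b *\<^sub>R u"
    by transfer (auto simp: scaleR_left_distrib
      intro: square_integrable_add square_integrable_scaleR)
  show "a *\<^sub>R b *\<^sub>R u = (a * b) *\<^sub>R u"
    by transfer (simp add: square_integrable_scaleR)
  show "1 *\<^sub>R u = u"
    by transfer simp
  show "sgn u = scaleR (inverse (norm u)) u" by (rule sgn_L2_def)
  show "dist u v = norm (u - v)" by (rule dist_L2_def)
  show "uniformity = (INF e\<in>{0<..}. principal {(u, v::'a L2). dist u v < e})"
    by (rule uniformity_L2_def)
  show "open S = (\<forall>u\<in>S. \<forall>\<^sub>F (u', v) in uniformity. u' = u \<longrightarrow> v \<in> S)" for S :: "'a L2 set"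
    by (rule open_L2_def)
  show "u \<bullet> v = v \<bullet> u"
    by transfer (simp add: inner_commute)
  show "(u + v) \<bullet> w = u \<bullet> w + v \<bullet> w"
    by transfer (simp add: inner_add_left square_integrable_inner)
  show "a *\<^sub>R u \<bullet> v = a * (u \<bullet> v)"
    by transfer simp
  show "0 \<le> u \<bullet> u"
    by transfer (simp add: integral_nonneg)
  show "u \<bullet> u = 0 \<longleftrightarrow> u = 0"
  proof transfer
    fix f :: "real^3 \<Rightarrow> 'a"
    assume "square_integrable f \<and> square_integrable f \<and> (AE x in lborel. f x = f x)"
    then have f: "square_integrable f" by simp
    have "(\<integral>x. f x \<bullet> f x \<partial>lborel) = 0 \<longleftrightarrow> (AE x in lborel. f x \<bullet> f x = 0)"
      by (rule integral_nonneg_eq_0_iff_AE) (simp_all add: square_integrable_inner f)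
    then show "(\<integral>x. f x \<bullet> f x \<partial>lborel) = 0 \<longleftrightarrow>
        square_integrable f \<and> square_integrable (\<lambda>x. 0::'a) \<and> (AE x in lborel. f x = 0)"
      using f by (simp add: square_integrable_zero)
  qed
  show "norm u = sqrt (u \<bullet> u)" by (rule norm_L2_def)
qed

end

text \<open>
  The space of square integrable fields on a domain is realised as the subspace of those fields
  on the whole space that vanish almost everywhere outside the domain (extension by zero is an
  isometry). Product types carry the Hilbert sum inner product, so that
  \<open>norm (E, H) ^ 2 = norm E ^ 2 + norm H ^ 2\<close>.
\<close>

definition L2_on :: "(real^3) set \<Rightarrow> 'a::euclidean_space L2 set" where
  "L2_on D = {u. AE x in lborel. x \<notin> D \<longrightarrow> rep_L2 u x = 0}"

section \<open>Smooth domains\<close>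

text \<open>Intended for open \<open>S\<close> and a finite-dimensional source, where it is \<open>C\<^sup>n\<close> regularity.\<close>

fun Ck_on :: "nat \<Rightarrow> ('a::real_normed_vector \<Rightarrow> 'b::real_normed_vector) \<Rightarrow> 'a set \<Rightarrow> bool" where
  "Ck_on 0 f S \<longleftrightarrow> continuous_on S f"
| "Ck_on (Suc n) f S \<longleftrightarrow>
     (\<forall>x\<in>S. f differentiable (at x)) \<and> (\<forall>v. Ck_on n (\<lambda>x. frechet_derivative f (at x) v) S)"

definition smooth_on :: "'a::real_normed_vector set \<Rightarrow> ('a \<Rightarrow> 'b::real_normed_vector) \<Rightarrow> bool" where
  "smooth_on S f \<longleftrightarrow> (\<forall>n. Ck_on n f S)"

text \<open>The domain lies locally on one side of its boundary, a regular level set of a smooth function.\<close>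

definition smooth_boundary :: "(real^3) set \<Rightarrow> bool" where
  "smooth_boundary D \<longleftrightarrow>
     (\<forall>p\<in>frontier D. \<exists>N. \<exists>\<rho> :: real^3 \<Rightarrow> real.
        open N \<and> p \<in> N \<and> smooth_on N \<rho> \<and>
        (\<forall>x\<in>N. frechet_derivative \<rho> (at x) \<noteq> (\<lambda>v. 0)) \<and>
        D \<inter> N = {x\<in>N. \<rho> x < 0})"

definition smooth_bounded_domain :: "(real^3) set \<Rightarrow> bool" where
  "smooth_bounded_domain D \<longleftrightarrow>
     D \<noteq> {} \<and> open D \<and> connected D \<and> bounded D \<and> smooth_boundary D"

section \<open>The Maxwell operator\<close>

definition partial_deriv :: "3 \<Rightarrow> 3 \<Rightarrow> (real^3 \<Rightarrow> real^3) \<Rightarrow> real^3 \<Rightarrow> real" where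
  "partial_deriv j i \<phi> x = frechet_derivative \<phi> (at x) (axis j 1) $ i"

definition classical_curl :: "(real^3 \<Rightarrow> real^3) \<Rightarrow> real^3 \<Rightarrow> real^3" where
  "classical_curl \<phi> x = vector
     [partial_deriv 2 3 \<phi> x - partial_deriv 3 2 \<phi> x,
      partial_deriv 3 1 \<phi> x - partial_deriv 1 3 \<phi> x,
      partial_deriv 1 2 \<phi> x - partial_deriv 2 1 \<phi> x]"

text \<open>Curl in the sense of distributions on \<open>D\<close>.\<close>

definition has_weak_curl :: "(real^3) set \<Rightarrow> (real^3) L2 \<Rightarrow> (real^3) L2 \<Rightarrow> bool" where
  "has_weak_curl D v w \<longleftrightarrow>
     (\<forall>\<phi>. smooth_on UNIV \<phi> \<and> compact (closure {x. \<phi> x \<noteq> 0}) \<and> closure {x. \<phi> x \<noteq> 0} \<subseteq> D \<longrightarrow>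
        (LINT x:D|lborel. rep_L2 w x \<bullet> \<phi> x) =
        (LINT x:D|lborel. rep_L2 v x \<bullet> classical_curl \<phi> x))"

definition H_curl :: "(real^3) set \<Rightarrow> (real^3) L2 set" where
  "H_curl D = {v \<in> L2_on D. \<exists>w\<in>L2_on D. has_weak_curl D v w}"

definition weak_curl :: "(real^3) set \<Rightarrow> (real^3) L2 \<Rightarrow> (real^3) L2" where
  "weak_curl D v = (THE w. w \<in> L2_on D \<and> has_weak_curl D v w)"

text \<open>
  The tangential trace \<open>n \<times> v\<close> of a field in \<open>H_curl D\<close> is not a function on the boundary but the
  functional on smooth fields \<open>\<phi>\<close> given by Green's formula: if \<open>v\<close> is smooth up to the boundary,
  the expression below is the surface integral of \<open>(n \<times> v) \<bullet> \<phi>\<close>, with \<open>n\<close> the outward unit normal.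
\<close>

definition tangential_trace :: "(real^3) set \<Rightarrow> (real^3) L2 \<Rightarrow> (real^3 \<Rightarrow> real^3) \<Rightarrow> real" where
  "tangential_trace D v \<phi> =
     (LINT x:D|lborel. rep_L2 (weak_curl D v) x \<bullet> \<phi> x) -
     (LINT x:D|lborel. rep_L2 v x \<bullet> classical_curl \<phi> x)"

definition H0_curl :: "(real^3) set \<Rightarrow> (real^3) L2 set" where
  "H0_curl D = {v \<in> H_curl D. \<forall>\<phi>. smooth_on UNIV \<phi> \<longrightarrow> tangential_trace D v \<phi> = 0}"

type_synonym em_field = "(real^3) L2 \<times> (real^3) L2"

definition em_space :: "(real^3) set \<Rightarrow> em_field set" where
  "em_space D = L2_on D \<times> L2_on D"

definition maxwell_dom :: "(real^3) set \<Rightarrow> em_field set" where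
  "maxwell_dom D = H0_curl D \<times> H_curl D"

definition maxwell :: "(real^3) set \<Rightarrow> em_field \<Rightarrow> em_field" where
  "maxwell D u = (weak_curl D (snd u), - weak_curl D (fst u))"

definition graph_norm :: "('v::real_normed_vector \<Rightarrow> 'v) \<Rightarrow> 'v \<Rightarrow> real" where
  "graph_norm A v = sqrt ((norm v)\<^sup>2 + (norm (A v))\<^sup>2)"

section \<open>Operators on subspaces\<close>

definition bounded_linear_on :: "'v::real_normed_vector set \<Rightarrow> ('v \<Rightarrow> 'v) \<Rightarrow> bool" where
  "bounded_linear_on V T \<longleftrightarrow>
     (\<forall>x\<in>V. T x \<in> V) \<and>
     (\<forall>x\<in>V. \<forall>y\<in>V. T (x + y) = T x + T y) \<and>
     (\<forall>c. \<forall>x\<in>V. T (c *\<^sub>R x) = c *\<^sub>R T x) \<and>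
     (\<exists>B. \<forall>x\<in>V. norm (T x) \<le> B * norm x)"

definition unitary_on :: "'v::real_inner set \<Rightarrow> ('v \<Rightarrow> 'v) \<Rightarrow> bool" where
  "unitary_on V T \<longleftrightarrow>
     bounded_linear_on V T \<and> T ` V = V \<and> (\<forall>x\<in>V. \<forall>y\<in>V. T x \<bullet> T y = x \<bullet> y)"

text \<open>\<open>S t = exp (t A)\<close>: the unitary strongly continuous group on \<open>V\<close> whose infinitesimal
  generator is \<open>A\<close> with domain \<open>DA\<close>.\<close>

definition unitary_C0_group_generated_by ::
  "'v::real_inner set \<Rightarrow> 'v set \<Rightarrow> ('v \<Rightarrow> 'v) \<Rightarrow> (real \<Rightarrow> 'v \<Rightarrow> 'v) \<Rightarrow> bool" where
  "unitary_C0_group_generated_by V DA A S \<longleftrightarrow>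
     (\<forall>t. unitary_on V (S t)) \<and>
     (\<forall>v\<in>V. S 0 v = v) \<and>
     (\<forall>s t. \<forall>v\<in>V. S (s + t) v = S s (S t v)) \<and>
     (\<forall>v\<in>V. ((\<lambda>t. S t v) \<longlongrightarrow> v) (at 0)) \<and>
     (\<forall>v\<in>V. \<forall>w\<in>V. ((\<lambda>h. (S h v - v) /\<^sub>R h) \<longlongrightarrow> w) (at 0) \<longleftrightarrow> v \<in> DA \<and> A v = w)"

definition orthonormal_basis :: "'v::real_inner set \<Rightarrow> (nat \<Rightarrow> 'v) \<Rightarrow> bool" where
  "orthonormal_basis V e \<longleftrightarrow>
     (\<forall>j k. e j \<bullet> e k = (if j = k then 1 else 0)) \<and> closure (span (range e)) = V"

definition nonneg_symmetric_on :: "'v::real_inner set \<Rightarrow> ('v \<Rightarrow> 'v) \<Rightarrow> bool" where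
  "nonneg_symmetric_on V T \<longleftrightarrow>
     bounded_linear_on V T \<and> (\<forall>x\<in>V. \<forall>y\<in>V. T x \<bullet> y = x \<bullet> T y) \<and> (\<forall>x\<in>V. 0 \<le> T x \<bullet> x)"

text \<open>For nonnegative symmetric operators the trace class condition is finiteness of the trace
  computed in some (equivalently, every) orthonormal basis.\<close>

definition nonneg_trace_class_on :: "'v::real_inner set \<Rightarrow> ('v \<Rightarrow> 'v) \<Rightarrow> bool" where
  "nonneg_trace_class_on V T \<longleftrightarrow>
     nonneg_symmetric_on V T \<and>
     (\<exists>f. orthonormal_basis V f \<and> summable (\<lambda>k. T (f k) \<bullet> f k))"

definition op_trace :: "'v::real_inner set \<Rightarrow> ('v \<Rightarrow> 'v) \<Rightarrow> real" where
  "op_trace V T = (THE r. \<forall>f. orthonormal_basis V f \<longrightarrow> (\<lambda>k. T (f k) \<bullet> f k) sums r)"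

definition is_sqrt_on :: "'v::real_inner set \<Rightarrow> ('v \<Rightarrow> 'v) \<Rightarrow> ('v \<Rightarrow> 'v) \<Rightarrow> bool" where
  "is_sqrt_on V R T \<longleftrightarrow> nonneg_symmetric_on V R \<and> (\<forall>x\<in>V. R (R x) = T x)"

section \<open>Stochastic basis and Wiener process\<close>

text \<open>Only times \<open>t \<ge> 0\<close> matter throughout.\<close>

definition stochastic_basis :: "'w measure \<Rightarrow> (real \<Rightarrow> 'w measure) \<Rightarrow> bool" where
  "stochastic_basis M F \<longleftrightarrow>
     prob_space M \<and> (\<forall>t\<ge>0. subalgebra M (F t)) \<and>
     (\<forall>s t. 0 \<le> s \<and> s \<le> t \<longrightarrow> subalgebra (F t) (F s))"

definition brownian_motion ::
  "'w measure \<Rightarrow> (real \<Rightarrow> 'w measure) \<Rightarrow> (real \<Rightarrow> 'w \<Rightarrow> real) \<Rightarrow> bool" where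
  "brownian_motion M F B \<longleftrightarrow>
     (\<forall>t\<ge>0. B t \<in> borel_measurable (F t)) \<and>
     (AE \<omega> in M. B 0 \<omega> = 0) \<and>
     (AE \<omega> in M. continuous_on {0..} (\<lambda>t. B t \<omega>)) \<and>
     (\<forall>s t. 0 \<le> s \<and> s < t \<longrightarrow>
        distributed M lborel (\<lambda>\<omega>. B t \<omega> - B s \<omega>) (\<lambda>x. ennreal (normal_density 0 (sqrt (t - s)) x)) \<and>
        prob_space.indep_set M (sets (F s))
          {(\<lambda>\<omega>. B t \<omega> - B s \<omega>) -` A \<inter> space M | A. A \<in> sets borel})"

definition independent_processes :: "'w measure \<Rightarrow> (nat \<Rightarrow> real \<Rightarrow> 'w \<Rightarrow> real) \<Rightarrow> bool" where
  "independent_processes M B \<longleftrightarrow>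
     prob_space.indep_vars M (\<lambda>_. Pi\<^sub>M {0..} (\<lambda>_. borel)) (\<lambda>k \<omega>. \<lambda>t\<in>{0..}. B k t \<omega>) UNIV"

text \<open>\<open>W t\<close> is the mean square limit of the series of \<open>\<beta> k t\<close> times \<open>R (e k)\<close>, where \<open>R\<close> is the
  square root of the covariance operator.\<close>

definition wiener_series ::
  "'w measure \<Rightarrow> 'v::real_inner set \<Rightarrow> ('v \<Rightarrow> 'v) \<Rightarrow> (nat \<Rightarrow> 'v) \<Rightarrow> (nat \<Rightarrow> real \<Rightarrow> 'w \<Rightarrow> real) \<Rightarrow>
   (real \<Rightarrow> 'w \<Rightarrow> 'v) \<Rightarrow> bool" where
  "wiener_series M V R e \<beta> W \<longleftrightarrow>
     (\<forall>t\<ge>0. W t \<in> borel_measurable M \<and> (\<forall>\<omega>\<in>space M. W t \<omega> \<in> V) \<and>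
        (\<lambda>n. \<integral>\<^sup>+\<omega>. ennreal ((norm (W t \<omega> - (\<Sum>k<n. \<beta> k t \<omega> *\<^sub>R R (e k))))\<^sup>2) \<partial>M)
          \<longlonglongrightarrow> 0)"

section \<open>The exponential integrator\<close>

lemma square_integrable_times_const:
  fixes f :: "real^3 \<Rightarrow> real" and c :: "'a::euclidean_space"
  assumes "square_integrable f"
  shows "square_integrable (\<lambda>x. f x *\<^sub>R c)"
  using assms by (auto simp: square_integrable_def power_mult_distrib)

lift_definition times_ones :: "real L2 \<Rightarrow> (real^3) L2" is "\<lambda>u x. u x *\<^sub>R (\<chi> i. 1)"
  by (intro conjI; elim conjE)
    (auto intro: square_integrable_times_const elim: eventually_mono)

definition noise_op :: "real \<Rightarrow> real \<Rightarrow> real L2 \<Rightarrow> em_field" where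
  "noise_op l1 l2 u = (l1 *\<^sub>R times_ones u, l2 *\<^sub>R times_ones u)"

primrec exp_integrator ::
  "(real \<Rightarrow> 'v \<Rightarrow> 'v) \<Rightarrow> ('u::real_vector \<Rightarrow> 'v) \<Rightarrow> (real \<Rightarrow> 'w \<Rightarrow> 'u) \<Rightarrow> real \<Rightarrow> ('w \<Rightarrow> 'v) \<Rightarrow>
   nat \<Rightarrow> 'w \<Rightarrow> 'v::real_vector" where
  "exp_integrator S G W \<Delta>t U0 0 \<omega> = U0 \<omega>"
| "exp_integrator S G W \<Delta>t U0 (Suc k) \<omega> =
     S \<Delta>t (exp_integrator S G W \<Delta>t U0 k \<omega>) +
     S \<Delta>t (G (W (real (Suc k) * \<Delta>t) \<omega> - W (real k * \<Delta>t) \<omega>))"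

definition energy :: "(real^3) set \<Rightarrow> em_field \<Rightarrow> real" where
  "energy D u =
     (LINT x:D|lborel. (norm (rep_L2 (fst u) x))\<^sup>2 + (norm (rep_L2 (snd u) x))\<^sup>2)"

end

theory Submission
  imports Defs
begin

text \<open>
  The energy of a state is the square of its norm in the space of pairs of square integrable
  fields on the domain, so everything takes place in Hilbert space. Put \<open>h = \<Delta>t\<close> and write
  \<open>U\<close> for the state after some step, \<open>\<Delta>W\<close> for the next noise increment and \<open>G\<close> for
  \<open>noise_op l1 l2\<close>. The next state is \<open>S h (U + G \<Delta>W)\<close> and \<open>S h\<close> is unitary, hence its energy is
  \<open>(norm U)\<^sup>2 + 2 * (U \<bullet> G \<Delta>W) + (norm (G \<Delta>W))\<^sup>2\<close>.

  The last term has expectation \<open>K * h\<close>. Indeed \<open>(norm (G u))\<^sup>2 = 3 * (l1\<^sup>2 + l2\<^sup>2) * (norm u)\<^sup>2\<close>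
  (\<open>norm_noise_op\<close>), and the mean square of \<open>\<Delta>W\<close> is \<open>h\<close> times the trace of the covariance
  (\<open>expectation_norm_\<Delta>W\<close>): the vectors \<open>R (e i)\<close>, with \<open>R\<close> the square root of the covariance, are
  pairwise orthogonal, and the sum of their squared norms is the trace, whichever basis is used to
  define it (\<open>op_trace_eq_Hilbert_Schmidt_norm\<close>).

  The middle term has expectation zero because the state depends on the past and \<open>\<Delta>W\<close> on a
  later interval of time (\<open>state_orthogonal_\<Delta>W\<close>). The precise form of this dependence that survives
  the induction over the steps is \<open>future_orthogonal\<close>: every coordinate of the state is orthogonal
  in mean square to all later increments of the Brownian motions. By independence this holds for
  the initial state; it is preserved by linear operations and by mean square limits, and so passes
  from the truncated noise to \<open>\<Delta>W\<close> and from one step to the next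
  (\<open>exp_integrator_energy\<close>).

  Two devices recur. All expectations that involve \<open>\<Delta>W\<close> are limits of those for finite partial
  sums of its series (\<open>expectation_tendsto_mean_square\<close>). Measurability of norms and inner products
  of vector-valued random variables is obtained from that of coordinates, through expansion in the
  orthonormal basis \<open>e\<close>.
\<close>

section \<open>Expansions in an orthonormal basis\<close>

definition partial_expansion :: "(nat \<Rightarrow> 'v::real_inner) \<Rightarrow> nat \<Rightarrow> 'v \<Rightarrow> 'v" where
  "partial_expansion e n x = (\<Sum>j<n. (x \<bullet> e j) *\<^sub>R e j)"

lemma inner_lincomb_orthonormal:
  fixes e :: "nat \<Rightarrow> 'v::real_inner"
  assumes "orthonormal_basis V e"
  shows "(\<Sum>j<n. c j *\<^sub>R e j) \<bullet> e i = (if i < n then c i else 0)"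
proof -
  have "e j \<bullet> e i = (if i = j then 1 else 0)" for j
    using assms by (auto simp: orthonormal_basis_def)
  then have "(\<Sum>j<n. c j *\<^sub>R e j) \<bullet> e i = (\<Sum>j<n. if i = j then c j else 0)"
    by (auto simp: inner_sum_left mult_delta_right)
  then show ?thesis by (simp add: sum.delta)
qed

lemma norm_partial_expansion:
  assumes "orthonormal_basis V e"
  shows "(norm (partial_expansion e n x))\<^sup>2 = (\<Sum>j<n. (x \<bullet> e j)\<^sup>2)"
  unfolding power2_norm_eq_inner
  by (subst (2) partial_expansion_def)
    (auto simp: partial_expansion_def inner_sum_right inner_lincomb_orthonormal[OF assms]
      power2_eq_square intro!: sum.cong)

lemma norm_partial_expansion_le:
  assumes "orthonormal_basis V e"
  shows "norm (partial_expansion e n x) \<le> norm x"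
proof -
  have "x \<bullet> partial_expansion e n x = (norm (partial_expansion e n x))\<^sup>2"
    unfolding norm_partial_expansion[OF assms]
    by (simp add: partial_expansion_def inner_sum_right power2_eq_square)
  then have "(norm (partial_expansion e n x))\<^sup>2 \<le> norm x * norm (partial_expansion e n x)"
    using norm_cauchy_schwarz[of x "partial_expansion e n x"] by simp
  then show ?thesis
    by (cases "partial_expansion e n x = 0") (auto simp: power2_eq_square)
qed

lemma partial_expansion_diff:
  "partial_expansion e n (x - y) = partial_expansion e n x - partial_expansion e n y"
  by (simp add: partial_expansion_def inner_diff_left scaleR_diff_left sum_subtractf)

text \<open>The partial expansions are contractions, so that convergence on the span, where they
  are eventually constant, carries over to its closure.\<close>

lemma partial_expansion_tendsto:
  assumes "orthonormal_basis V e" "x \<in> V"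
  shows "(\<lambda>n. partial_expansion e n x) \<longlonglongrightarrow> x"
proof (rule LIMSEQ_I)
  fix r :: real assume "0 < r"
  have "x \<in> closure (span (range e))" using assms by (simp add: orthonormal_basis_def)
  then obtain y where y: "y \<in> span (range e)" "dist y x < r / 2"
    using \<open>0 < r\<close> by (meson closure_approachable half_gt_zero)
  from y(1) have "\<forall>\<^sub>F n in sequentially. partial_expansion e n y = y"
  proof (induction rule: span_induct_alt)
    case base
    then show ?case by (simp add: partial_expansion_def)
  next
    case (step c z y)
    then obtain i where z: "z = e i" by auto
    have i: "partial_expansion e n (e i) = e i" if "n > i" for n
    proof -
      have "(e i \<bullet> e j) *\<^sub>R e j = (if i = j then e j else 0)" for j
        using assms(1) by (auto simp: orthonormal_basis_def)
      then have "partial_expansion e n (e i) = (\<Sum>j<n. if i = j then e j else 0)"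
        by (simp add: partial_expansion_def)
      then show ?thesis using that by (simp add: sum.delta)
    qed
    have lin: "partial_expansion e n (c *\<^sub>R z + y)
        = c *\<^sub>R partial_expansion e n z + partial_expansion e n y" for n
      by (simp add: partial_expansion_def inner_add_left scaleR_add_left sum.distrib
          scaleR_sum_right)
    show ?case
      using step.IH eventually_gt_at_top[of i]
      by eventually_elim (simp only: lin, simp add: z i)
  qed
  then obtain N where N: "\<And>n. n \<ge> N \<Longrightarrow> partial_expansion e n y = y"
    by (auto simp: eventually_sequentially)
  have "norm (partial_expansion e n x - x) < r" if "n \<ge> N" for n
  proof -
    have "partial_expansion e n x - x = partial_expansion e n (x - y) + (y - x)"
      by (simp add: partial_expansion_diff N[OF that])
    then have "norm (partial_expansion e n x - x) \<le> norm (x - y) + norm (y - x)"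
      by (simp only: norm_triangle_mono[OF norm_partial_expansion_le[OF assms(1)] order_refl])
    also have "\<dots> < r" using y(2) by (simp add: dist_norm norm_minus_commute)
    finally show ?thesis .
  qed
  then show "\<exists>no. \<forall>n\<ge>no. norm (partial_expansion e n x - x) < r" by blast
qed

lemma Parseval_norm:
  assumes "orthonormal_basis V e" "x \<in> V"
  shows "(\<lambda>j. (x \<bullet> e j)\<^sup>2) sums (norm x)\<^sup>2"
  unfolding sums_def norm_partial_expansion[OF assms(1), symmetric]
  by (intro tendsto_intros partial_expansion_tendsto[OF assms])

lemma subspace_closure:
  fixes S :: "'v::real_normed_vector set"
  assumes "subspace S"
  shows "subspace (closure S)"
  unfolding subspace_def
proof (intro conjI ballI allI)
  show "0 \<in> closure S" using assms closure_subset[of S] subspace_0 by blast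
  fix x y assume "x \<in> closure S" "y \<in> closure S"
  then obtain a b where "\<And>n. a n \<in> S" "\<And>n. b n \<in> S" "a \<longlonglongrightarrow> x" "b \<longlonglongrightarrow> y"
    by (auto simp: closure_sequential)
  then show "x + y \<in> closure S"
    unfolding closure_sequential using assms
    by (intro exI[of _ "\<lambda>n. a n + b n"] conjI allI tendsto_add subspace_add)
next
  fix c x assume "x \<in> closure S"
  then obtain a where "\<And>n. a n \<in> S" "a \<longlonglongrightarrow> x"
    by (auto simp: closure_sequential)
  then show "c *\<^sub>R x \<in> closure S"
    unfolding closure_sequential using assms
    by (intro exI[of _ "\<lambda>n. c *\<^sub>R a n"] conjI allI tendsto_scaleR tendsto_const subspace_scale)
qed

lemma orthonormal_basis_subspace:
  assumes "orthonormal_basis V e"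
  shows "subspace V" "e i \<in> V"
  using assms closure_subset[of "span (range e)"] span_base[of "e i" "range e"]
    subspace_closure[OF subspace_span[of "range e"]]
  by (auto simp: orthonormal_basis_def)

section \<open>The trace of a covariance operator\<close>

text \<open>Both sums equal the sum over all pairs of the squared matrix entries of \<open>R\<close> with respect
  to the two bases, added up in either order.\<close>

lemma Hilbert_Schmidt_norm_basis_independent:
  assumes f: "orthonormal_basis V f" and g: "orthonormal_basis V g"
    and R: "nonneg_symmetric_on V R"
    and s: "(\<lambda>k. (norm (R (f k)))\<^sup>2) sums r"
  shows "(\<lambda>k. (norm (R (g k)))\<^sup>2) sums r"
proof -
  have RV: "R x \<in> V" if "x \<in> V" for x
    using R that by (auto simp: nonneg_symmetric_on_def bounded_linear_on_def)
  have sym: "R x \<bullet> y = x \<bullet> R y" if "x \<in> V" "y \<in> V" for x y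
    using R that by (auto simp: nonneg_symmetric_on_def)
  note fV = orthonormal_basis_subspace(2)[OF f] and gV = orthonormal_basis_subspace(2)[OF g]
  have row: "(\<Sum>j. ennreal ((R (g k) \<bullet> f j)\<^sup>2)) = ennreal ((norm (R (g k)))\<^sup>2)" for k
    by (rule suminf_ennreal_eq[OF zero_le_power2 Parseval_norm[OF f RV[OF gV]]])
  have "(\<lambda>k. (R (g k) \<bullet> f j)\<^sup>2) sums (norm (R (f j)))\<^sup>2" for j
  proof -
    have "R (f j) \<bullet> g k = R (g k) \<bullet> f j" for k
      by (subst sym[OF fV gV]) (rule inner_commute)
    then show ?thesis using Parseval_norm[OF g RV[OF fV], of j] by simp
  qed
  then have col: "(\<Sum>k. ennreal ((R (g k) \<bullet> f j)\<^sup>2)) = ennreal ((norm (R (f j)))\<^sup>2)" for j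
    by (rule suminf_ennreal_eq[OF zero_le_power2])
  have "(\<Sum>k. ennreal ((norm (R (g k)))\<^sup>2)) = (\<Sum>k. \<Sum>j. ennreal ((R (g k) \<bullet> f j)\<^sup>2))"
    by (simp add: row)
  also have "\<dots> = (\<Sum>j. \<Sum>k. ennreal ((R (g k) \<bullet> f j)\<^sup>2))"
    by (subst (1 2) nn_integral_count_space_nat[symmetric], rule nn_integral_suminf) simp
  also have "\<dots> = (\<Sum>j. ennreal ((norm (R (f j)))\<^sup>2))"
    by (simp add: col)
  also have "\<dots> = ennreal r"
    by (rule suminf_ennreal_eq[OF zero_le_power2 s])
  finally have "(\<lambda>k. ennreal ((norm (R (g k)))\<^sup>2)) sums ennreal r"
    using summable_sums[OF summableI] by metis
  moreover have "0 \<le> r"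
    by (rule sums_le[OF zero_le_power2 sums_zero s])
  ultimately show ?thesis by (simp only: sums_ennreal[OF zero_le_power2])
qed

lemma inner_sqrt_operator:
  assumes "is_sqrt_on V R Q" "x \<in> V" "y \<in> V"
  shows "R x \<bullet> R y = x \<bullet> Q y"
  using assms by (auto simp: is_sqrt_on_def nonneg_symmetric_on_def bounded_linear_on_def)

text \<open>The definite description in \<open>op_trace\<close> is meaningful because the value obtained from
  some basis with a convergent diagonal sum is shared by every other basis.\<close>

lemma op_trace_eq_Hilbert_Schmidt_norm:
  assumes Q: "nonneg_trace_class_on V Q" and R: "is_sqrt_on V R Q"
    and e: "orthonormal_basis V e"
  shows "(\<lambda>k. (norm (R (e k)))\<^sup>2) sums op_trace V Q"
proof -
  have R': "nonneg_symmetric_on V R" using R by (simp add: is_sqrt_on_def)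
  have diag: "Q (f k) \<bullet> f k = (norm (R (f k)))\<^sup>2" if "orthonormal_basis V f" for f k
    using inner_sqrt_operator[OF R, of "f k" "f k"] orthonormal_basis_subspace(2)[OF that]
    by (simp add: power2_norm_eq_inner inner_commute)
  obtain f where f: "orthonormal_basis V f" "summable (\<lambda>k. Q (f k) \<bullet> f k)"
    using Q by (auto simp: nonneg_trace_class_on_def)
  then obtain r where r: "(\<lambda>k. (norm (R (f k)))\<^sup>2) sums r"
    by (auto simp: diag summable_def)
  have all: "(\<lambda>k. Q (g k) \<bullet> g k) sums r" if g: "orthonormal_basis V g" for g
    using Hilbert_Schmidt_norm_basis_independent[OF f(1) g R' r] by (simp add: diag[OF g])
  have "op_trace V Q = r"
    unfolding op_trace_def
    by (rule the_equality) (use all f(1) sums_unique2 in blast)+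
  then show ?thesis using all[OF e] by (simp add: diag[OF e])
qed

section \<open>Passing to mean square limits\<close>

text \<open>By Cauchy--Schwarz, \<open>\<integral>\<bar>f - fn n\<bar>\<close> is at most the product of the \<open>L\<^sup>2\<close> norms of \<open>a\<close> and
  \<open>d n\<close>. Every expectation below that involves the Wiener process is obtained from its
  truncations in this way.\<close>

lemma expectation_tendsto_mean_square:
  fixes a f :: "'w \<Rightarrow> real" and d fn :: "nat \<Rightarrow> 'w \<Rightarrow> real"
  assumes [measurable]: "a \<in> borel_measurable M" "f \<in> borel_measurable M"
      "\<And>n. d n \<in> borel_measurable M"
    and a: "integrable M (\<lambda>\<omega>. (a \<omega>)\<^sup>2)" and fn: "\<And>n. integrable M (fn n)"
    and d: "(\<lambda>n. \<integral>\<^sup>+\<omega>. ennreal ((d n \<omega>)\<^sup>2) \<partial>M) \<longlonglongrightarrow> 0"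
    and bound: "\<And>n \<omega>. \<omega> \<in> space M \<Longrightarrow> \<bar>f \<omega> - fn n \<omega>\<bar> \<le> \<bar>a \<omega>\<bar> * \<bar>d n \<omega>\<bar>"
  shows "integrable M f" "(\<lambda>n. \<integral>\<omega>. fn n \<omega> \<partial>M) \<longlonglongrightarrow> (\<integral>\<omega>. f \<omega> \<partial>M)"
proof -
  have [measurable]: "fn n \<in> borel_measurable M" for n using fn by auto
  define A where "A = (\<integral>\<^sup>+\<omega>. ennreal ((a \<omega>)\<^sup>2) \<partial>M)"
  define I where "I n = (\<integral>\<^sup>+\<omega>. ennreal \<bar>f \<omega> - fn n \<omega>\<bar> \<partial>M)" for n
  define Dn where "Dn n = (\<integral>\<^sup>+\<omega>. ennreal ((d n \<omega>)\<^sup>2) \<partial>M)" for n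
  have A: "A < \<infinity>" using a unfolding A_def by (simp add: integrable_iff_bounded)
  have I2: "(I n)\<^sup>2 \<le> A * Dn n" for n
  proof -
    have "I n \<le> (\<integral>\<^sup>+\<omega>. ennreal \<bar>a \<omega>\<bar> * ennreal \<bar>d n \<omega>\<bar> \<partial>M)"
      unfolding I_def by (intro nn_integral_mono) (simp add: bound ennreal_mult[symmetric])
    then have "(I n)\<^sup>2 \<le> (\<integral>\<^sup>+\<omega>. ennreal \<bar>a \<omega>\<bar> * ennreal \<bar>d n \<omega>\<bar> \<partial>M)\<^sup>2"
      by (intro power_mono) simp_all
    also have "\<dots> \<le> (\<integral>\<^sup>+\<omega>. (ennreal \<bar>a \<omega>\<bar>)\<^sup>2 \<partial>M) * (\<integral>\<^sup>+\<omega>. (ennreal \<bar>d n \<omega>\<bar>)\<^sup>2 \<partial>M)"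
      by (rule Cauchy_Schwarz_nn_integral) simp_all
    finally show ?thesis by (simp add: A_def Dn_def ennreal_power)
  qed
  have "(\<lambda>n. A * Dn n) \<longlonglongrightarrow> A * 0"
    using d A unfolding Dn_def[symmetric] by (intro ennreal_tendsto_cmult) simp_all
  then have AD: "(\<lambda>n. A * Dn n) \<longlonglongrightarrow> 0" by simp
  have I0: "I \<longlonglongrightarrow> 0"
  proof (rule order_tendstoI)
    fix u :: ennreal assume "0 < u"
    then obtain v :: real where v: "0 < ennreal v" "ennreal v < u"
      by (metis dense ennreal_cases less_top_ennreal order.strict_trans)
    have "0 < (ennreal v)\<^sup>2"
      using v(1) unfolding zero_less_iff_neq_zero by (rule power_not_zero)
    then have "\<forall>\<^sub>F n in sequentially. A * Dn n < (ennreal v)\<^sup>2"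
      using AD by (rule order_tendstoD(2)[rotated])
    then show "\<forall>\<^sub>F n in sequentially. I n < u"
    proof eventually_elim
      case (elim n)
      then have "(I n)\<^sup>2 < (ennreal v)\<^sup>2" using I2[of n] by (rule order.strict_trans1[rotated])
      then have "I n < ennreal v" by (meson not_le power_mono zero_le)
      then show ?case using v(2) by simp
    qed
  qed simp
  show f: "integrable M f"
  proof -
    have "\<forall>\<^sub>F n in sequentially. I n < \<infinity>" using I0 by (intro order_tendstoD(2)) auto
    then obtain n where "I n < \<infinity>" by (auto simp: eventually_sequentially)
    then have "integrable M (\<lambda>\<omega>. f \<omega> - fn n \<omega>)"
      unfolding I_def by (simp add: integrable_iff_bounded)
    from Bochner_Integration.integrable_add[OF this fn[of n]] show ?thesis by simp
  qed
  have le: "norm ((\<integral>\<omega>. fn n \<omega> \<partial>M) - (\<integral>\<omega>. f \<omega> \<partial>M)) \<le> enn2real (I n)" for n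
  proof -
    have "norm (\<integral>\<omega>. f \<omega> - fn n \<omega> \<partial>M) \<le> (\<integral>\<omega>. norm (f \<omega> - fn n \<omega>) \<partial>M)"
      by (rule integral_norm_bound)
    also have "\<dots> = enn2real (I n)"
      unfolding I_def by (subst integral_eq_nn_integral) auto
    finally show ?thesis using f fn[of n] by (simp add: abs_minus_commute)
  qed
  have "(\<lambda>n. enn2real (I n)) \<longlonglongrightarrow> enn2real 0"
    using I0 by (intro tendsto_enn2real) auto
  then have "(\<lambda>n. (\<integral>\<omega>. fn n \<omega> \<partial>M) - (\<integral>\<omega>. f \<omega> \<partial>M)) \<longlonglongrightarrow> 0"
    by (intro Lim_null_comparison[OF always_eventually[OF allI[OF le]]]) simp
  then show "(\<lambda>n. \<integral>\<omega>. fn n \<omega> \<partial>M) \<longlonglongrightarrow> (\<integral>\<omega>. f \<omega> \<partial>M)"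
    by (rule LIM_zero_cancel)
qed

section \<open>Brownian increments\<close>

lemma brownian_increment_moments:
  assumes "prob_space M" "brownian_motion M F B" "0 \<le> s" "s < t"
  shows "integrable M (\<lambda>\<omega>. B t \<omega> - B s \<omega>)"
    and "prob_space.expectation M (\<lambda>\<omega>. B t \<omega> - B s \<omega>) = 0"
    and "integrable M (\<lambda>\<omega>. (B t \<omega> - B s \<omega>)\<^sup>2)"
    and "prob_space.expectation M (\<lambda>\<omega>. (B t \<omega> - B s \<omega>)\<^sup>2) = t - s"
proof -
  interpret prob_space M by fact
  have D: "distributed M lborel (\<lambda>\<omega>. B t \<omega> - B s \<omega>) (normal_density 0 (sqrt (t - s)))"
    using assms by (auto simp: brownian_motion_def)
  have pos: "0 < sqrt (t - s)" using assms by simp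
  show "integrable M (\<lambda>\<omega>. B t \<omega> - B s \<omega>)"
    using integrable_normal_moment_nz_1[OF pos] distributed_integrable_var[OF D] by simp
  show E: "expectation (\<lambda>\<omega>. B t \<omega> - B s \<omega>) = 0"
    by (rule normal_distributed_expectation[OF pos D])
  show "integrable M (\<lambda>\<omega>. (B t \<omega> - B s \<omega>)\<^sup>2)"
    using integrable_normal_moment[OF pos, of 0 2] distributed_integrable[OF D, of "\<lambda>x. x\<^sup>2"]
    by simp
  show "expectation (\<lambda>\<omega>. (B t \<omega> - B s \<omega>)\<^sup>2) = t - s"
    using normal_distributed_variance[OF pos D] assms by (simp only: E) simp
qed

text \<open>The expectation of the product of independent variables factors, and the increment is
  centred.\<close>

lemma brownian_increment_orthogonal_past:
  assumes "prob_space M" "stochastic_basis M F" "brownian_motion M F B" "0 \<le> s" "s < t"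
    and Y: "Y \<in> borel_measurable (F s)" "integrable M Y"
  shows "prob_space.expectation M (\<lambda>\<omega>. Y \<omega> * (B t \<omega> - B s \<omega>)) = 0"
proof -
  interpret prob_space M by fact
  let ?b = "\<lambda>\<omega>. B t \<omega> - B s \<omega>"
  note b = brownian_increment_moments[OF assms(1,3-5)]
  have sub: "subalgebra M (F s)" using assms by (auto simp: stochastic_basis_def)
  then have sp: "space (F s) = space M" by (simp add: subalgebra_def)
  have "indep_set (sets (F s)) {?b -` A \<inter> space M | A. A \<in> sets borel}"
    using assms by (auto simp: brownian_motion_def)
  then have "indep_set {Y -` A \<inter> space M | A. A \<in> sets borel} {?b -` A \<inter> space M | A. A \<in> sets borel}"
    unfolding indep_set_def
    by (rule indep_sets_mono_sets)
      (use Y(1) sp in \<open>auto split: bool.splits dest!: measurable_sets\<close>)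
  then have "indep_var borel Y borel ?b"
    unfolding indep_var_eq using Y(2) b(1)
    by (intro conjI indep_set_sigma_sets) (auto simp: Int_stable_def intro: exI[of _ "_ \<inter> _"])
  from indep_var_lebesgue_integral[OF this Y(2) b(1)] show ?thesis
    by (simp add: b(2))
qed

section \<open>Random vectors with finite second moment\<close>

lemma integrable_mult_square_integrable:
  fixes f g :: "'w \<Rightarrow> real"
  assumes [measurable]: "f \<in> borel_measurable M" "g \<in> borel_measurable M"
    and "integrable M (\<lambda>\<omega>. (f \<omega>)\<^sup>2)" "integrable M (\<lambda>\<omega>. (g \<omega>)\<^sup>2)"
  shows "integrable M (\<lambda>\<omega>. f \<omega> * g \<omega>)"
proof (rule Bochner_Integration.integrable_bound)
  show "integrable M (\<lambda>\<omega>. (f \<omega>)\<^sup>2 + (g \<omega>)\<^sup>2)" using assms by simp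
  have "\<bar>f \<omega> * g \<omega>\<bar> \<le> (f \<omega>)\<^sup>2 + (g \<omega>)\<^sup>2" for \<omega>
    using sum_squares_bound[of "f \<omega>" "g \<omega>"] sum_squares_bound[of "f \<omega>" "- g \<omega>"]
      zero_le_power2[of "f \<omega>"] zero_le_power2[of "g \<omega>"]
    by (simp add: abs_le_iff)
  then show "AE \<omega> in M. norm (f \<omega> * g \<omega>) \<le> norm ((f \<omega>)\<^sup>2 + (g \<omega>)\<^sup>2)" by simp
qed simp

lemma norm_diff_square_le:
  fixes x y :: "'v::real_inner"
  shows "(norm (x - y))\<^sup>2 \<le> 2 * (norm x)\<^sup>2 + 2 * (norm y)\<^sup>2"
proof -
  have "(norm (x - y))\<^sup>2 + (norm (x + y))\<^sup>2 = 2 * (norm x)\<^sup>2 + 2 * (norm y)\<^sup>2"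
    by (simp add: power2_norm_eq_inner inner_simps inner_commute)
  then show ?thesis by (smt (verit) zero_le_power2)
qed

lemma borel_measurable_bounded_linear:
  fixes X :: "'w \<Rightarrow> 'v::real_normed_vector" and \<phi> :: "'v \<Rightarrow> real"
  assumes "bounded_linear \<phi>" "X \<in> borel_measurable M"
  shows "(\<lambda>\<omega>. \<phi> (X \<omega>)) \<in> borel_measurable M"
  using assms(2) by (rule measurable_compose)
    (intro borel_measurable_continuous_onI linear_continuous_on assms(1))

lemma integrable_square_bounded_linear:
  fixes X :: "'w \<Rightarrow> 'v::real_normed_vector" and \<phi> :: "'v \<Rightarrow> real"
  assumes \<phi>: "bounded_linear \<phi>" and X: "(\<lambda>\<omega>. \<phi> (X \<omega>)) \<in> borel_measurable M"
    "integrable M (\<lambda>\<omega>. (norm (X \<omega>))\<^sup>2)"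
  shows "integrable M (\<lambda>\<omega>. (\<phi> (X \<omega>))\<^sup>2)"
proof -
  obtain C where C: "\<And>x. norm (\<phi> x) \<le> norm x * C" using bounded_linear.bounded[OF \<phi>] by blast
  show ?thesis
  proof (rule Bochner_Integration.integrable_bound)
    show "integrable M (\<lambda>\<omega>. (norm (X \<omega>))\<^sup>2 * C\<^sup>2)" using X(2) by simp
    have "(\<phi> (X \<omega>))\<^sup>2 \<le> (norm (X \<omega>))\<^sup>2 * C\<^sup>2" for \<omega>
      using power_mono[OF C[of "X \<omega>"], of 2] by (simp add: power_mult_distrib)
    then show "AE \<omega> in M. norm ((\<phi> (X \<omega>))\<^sup>2) \<le> norm ((norm (X \<omega>))\<^sup>2 * C\<^sup>2)" by simp
  qed (use X(1) in simp)
qed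

text \<open>Sums of Borel measurable maps into a vector space without a known countable base need not be
  measurable, so measurability is handled coordinatewise. By Parseval's identity the squared norm
  is a countable sum of squares of coordinates.\<close>

lemma borel_measurable_norm_square_coordinates:
  assumes e: "orthonormal_basis V e"
    and X: "\<And>\<omega>. \<omega> \<in> space M \<Longrightarrow> X \<omega> \<in> V" "\<And>j. (\<lambda>\<omega>. X \<omega> \<bullet> e j) \<in> borel_measurable M"
  shows "(\<lambda>\<omega>. norm (X \<omega>)) \<in> borel_measurable M"
proof -
  have "norm (X \<omega>) = sqrt (\<Sum>j. (X \<omega> \<bullet> e j)\<^sup>2)" if "\<omega> \<in> space M" for \<omega>
    using sums_unique[OF Parseval_norm[OF e X(1)[OF that]]]
    by (metis norm_ge_zero real_sqrt_abs abs_of_nonneg)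
  moreover have "(\<lambda>\<omega>. sqrt (\<Sum>j. (X \<omega> \<bullet> e j)\<^sup>2)) \<in> borel_measurable M"
    using X(2) by measurable
  ultimately show ?thesis by (simp cong: measurable_cong)
qed

section \<open>Increments of a Wiener process with values in an inner product space\<close>

locale wiener_process =
  fixes M :: "'w measure" and F :: "real \<Rightarrow> 'w measure"
    and V :: "'u::real_inner set" and Q R :: "'u \<Rightarrow> 'u"
    and e :: "nat \<Rightarrow> 'u" and \<eta> :: "nat \<Rightarrow> real"
    and \<beta> :: "nat \<Rightarrow> real \<Rightarrow> 'w \<Rightarrow> real" and W :: "real \<Rightarrow> 'w \<Rightarrow> 'u"
  assumes basis: "stochastic_basis M F"
    and covariance: "nonneg_trace_class_on V Q"
    and eigenbasis: "orthonormal_basis V e" "\<And>k. Q (e k) = \<eta> k *\<^sub>R e k"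
    and sqrt_cov: "is_sqrt_on V R Q"
    and brownian: "\<And>k. brownian_motion M F (\<beta> k)"
    and wiener: "wiener_series M V R e \<beta> W"
begin

sublocale prob_space M
  using basis by (simp add: stochastic_basis_def)

definition \<Delta>\<beta> :: "nat \<Rightarrow> real \<Rightarrow> real \<Rightarrow> 'w \<Rightarrow> real" where
  "\<Delta>\<beta> j s t \<omega> = \<beta> j t \<omega> - \<beta> j s \<omega>"

definition \<Delta>W :: "real \<Rightarrow> real \<Rightarrow> 'w \<Rightarrow> 'u" where
  "\<Delta>W s t \<omega> = W t \<omega> - W s \<omega>"

definition truncated_\<Delta>W :: "nat \<Rightarrow> real \<Rightarrow> real \<Rightarrow> 'w \<Rightarrow> 'u" where
  "truncated_\<Delta>W n s t \<omega> = (\<Sum>i<n. \<Delta>\<beta> i s t \<omega> *\<^sub>R R (e i))"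

lemma F_measurable_mono:
  assumes "Y \<in> borel_measurable (F s)" "0 \<le> s" "s \<le> t"
  shows "Y \<in> borel_measurable (F t)"
  using basis assms by (intro measurable_from_subalg[of "F t" "F s"]) (auto simp: stochastic_basis_def)

lemma F_measurable_imp_measurable:
  assumes "Y \<in> borel_measurable (F s)" "0 \<le> s"
  shows "Y \<in> borel_measurable M"
  using basis assms by (intro measurable_from_subalg[of M "F s"]) (auto simp: stochastic_basis_def)

lemma \<beta>_adapted: "0 \<le> t \<Longrightarrow> \<beta> j t \<in> borel_measurable (F t)"
  using brownian[of j] by (simp add: brownian_motion_def)

lemma \<Delta>\<beta>_moments:
  assumes "0 \<le> s" "s < t"
  shows "\<Delta>\<beta> j s t \<in> borel_measurable M" "integrable M (\<lambda>\<omega>. (\<Delta>\<beta> j s t \<omega>)\<^sup>2)"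
    "expectation (\<lambda>\<omega>. (\<Delta>\<beta> j s t \<omega>)\<^sup>2) = t - s"
  using brownian_increment_moments[OF prob_space_axioms brownian[of j] assms]
  by (auto simp: \<Delta>\<beta>_def[abs_def])

lemma R_in_V: "R (e i) \<in> V"
  using sqrt_cov orthonormal_basis_subspace(2)[OF eigenbasis(1)]
  by (auto simp: is_sqrt_on_def nonneg_symmetric_on_def bounded_linear_on_def)

text \<open>The inner product equals \<open>e i \<bullet> Q (e j)\<close>, and \<open>e j\<close> is an eigenvector of \<open>Q\<close>.\<close>

lemma R_basis_orthogonal: "R (e i) \<bullet> R (e j) = (if i = j then (norm (R (e i)))\<^sup>2 else 0)"
proof (cases "i = j")
  case False
  have "R (e i) \<bullet> R (e j) = e i \<bullet> Q (e j)"
    by (intro inner_sqrt_operator[OF sqrt_cov] orthonormal_basis_subspace(2)[OF eigenbasis(1)])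
  also have "\<dots> = 0"
    using False eigenbasis by (simp add: orthonormal_basis_def)
  finally show ?thesis using False by simp
qed (simp add: power2_norm_eq_inner)

lemma \<Delta>W_in_V:
  assumes "0 \<le> s" "s < t" "\<omega> \<in> space M"
  shows "\<Delta>W s t \<omega> \<in> V"
  unfolding \<Delta>W_def
  using wiener assms by (intro subspace_diff orthonormal_basis_subspace[OF eigenbasis(1)])
    (auto simp: wiener_series_def)

lemma truncated_\<Delta>W_in_V: "truncated_\<Delta>W n s t \<omega> \<in> V"
  unfolding truncated_\<Delta>W_def using orthonormal_basis_subspace[OF eigenbasis(1)] R_in_V
  by (intro subspace_sum subspace_scale)

lemma \<Delta>W_functional_measurable:
  assumes "0 \<le> s" "s < t" "bounded_linear \<phi>"
  shows "(\<lambda>\<omega>. \<phi> (\<Delta>W s t \<omega>) :: real) \<in> borel_measurable M"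
  unfolding \<Delta>W_def linear_diff[OF bounded_linear.linear[OF assms(3)]]
  using wiener assms(1,2) by (intro borel_measurable_diff borel_measurable_bounded_linear[OF assms(3)])
    (auto simp: wiener_series_def)

lemma \<Delta>W_inner_measurable [measurable]:
  assumes "0 \<le> s" "s < t"
  shows "(\<lambda>\<omega>. \<Delta>W s t \<omega> \<bullet> v) \<in> borel_measurable M"
  by (rule \<Delta>W_functional_measurable[OF assms bounded_linear_inner_left])

lemma norm_\<Delta>W_measurable:
  assumes "0 \<le> s" "s < t"
  shows "(\<lambda>\<omega>. norm (\<Delta>W s t \<omega>)) \<in> borel_measurable M"
  using assms by (intro borel_measurable_norm_square_coordinates[OF eigenbasis(1)]) 
    (auto intro: \<Delta>W_in_V)

lemma truncation_error_measurable:
  assumes "0 \<le> s" "s < t"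
  shows "(\<lambda>\<omega>. norm (\<Delta>W s t \<omega> - truncated_\<Delta>W n s t \<omega>)) \<in> borel_measurable M"
proof (rule borel_measurable_norm_square_coordinates[OF eigenbasis(1)])
  show "\<Delta>W s t \<omega> - truncated_\<Delta>W n s t \<omega> \<in> V" if "\<omega> \<in> space M" for \<omega>
    using assms that by (intro subspace_diff orthonormal_basis_subspace[OF eigenbasis(1)]
        \<Delta>W_in_V truncated_\<Delta>W_in_V)
  show "(\<lambda>\<omega>. (\<Delta>W s t \<omega> - truncated_\<Delta>W n s t \<omega>) \<bullet> e j) \<in> borel_measurable M" for j
    unfolding inner_diff_left truncated_\<Delta>W_def inner_sum_left
    using assms \<Delta>\<beta>_moments(1)[OF assms] by simp
qed

text \<open>The error for the increment is the difference of the errors of the series at the two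
  endpoints, each of which vanishes in mean square.\<close>

lemma truncation_error_tendsto_0:
  assumes "0 \<le> s" "s < t"
  shows "(\<lambda>n. \<integral>\<^sup>+\<omega>. ennreal ((norm (\<Delta>W s t \<omega> - truncated_\<Delta>W n s t \<omega>))\<^sup>2) \<partial>M) \<longlonglongrightarrow> 0"
proof -
  define X where "X n r \<omega> = W r \<omega> - (\<Sum>k<n. \<beta> k r \<omega> *\<^sub>R R (e k))" for n r \<omega>
  have [measurable]: "(\<lambda>\<omega>. norm (X n r \<omega>)) \<in> borel_measurable M" if "0 \<le> r" for n r
  proof (rule borel_measurable_norm_square_coordinates[OF eigenbasis(1)])
    show "X n r \<omega> \<in> V" if "\<omega> \<in> space M" for \<omega>
      unfolding X_def using wiener \<open>0 \<le> r\<close> that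
      by (intro subspace_diff subspace_sum subspace_scale R_in_V
          orthonormal_basis_subspace[OF eigenbasis(1)]) (auto simp: wiener_series_def)
    have "\<beta> k r \<in> borel_measurable M" for k
      using F_measurable_imp_measurable[OF \<beta>_adapted] \<open>0 \<le> r\<close> by blast
    then show "(\<lambda>\<omega>. X n r \<omega> \<bullet> e j) \<in> borel_measurable M" for j
      unfolding X_def inner_diff_left inner_sum_left inner_scaleR_left
      using wiener \<open>0 \<le> r\<close>
      by (intro borel_measurable_diff borel_measurable_sum
        borel_measurable_bounded_linear[OF bounded_linear_inner_left]
        borel_measurable_times) (auto simp: wiener_series_def)
  qed
  define N where "N n r = (\<integral>\<^sup>+\<omega>. ennreal ((norm (X n r \<omega>))\<^sup>2) \<partial>M)" for n r
  have N0: "(\<lambda>n. N n r) \<longlonglongrightarrow> 0" if "0 \<le> r" for r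
    using wiener that by (simp add: N_def X_def wiener_series_def)
  have le: "(\<integral>\<^sup>+\<omega>. ennreal ((norm (\<Delta>W s t \<omega> - truncated_\<Delta>W n s t \<omega>))\<^sup>2) \<partial>M)
      \<le> 2 * N n t + 2 * N n s" for n
  proof -
    have "\<Delta>W s t \<omega> - truncated_\<Delta>W n s t \<omega> = X n t \<omega> - X n s \<omega>" for \<omega>
      by (simp add: \<Delta>W_def truncated_\<Delta>W_def \<Delta>\<beta>_def X_def sum_subtractf scaleR_diff_left)
    then have "(\<integral>\<^sup>+\<omega>. ennreal ((norm (\<Delta>W s t \<omega> - truncated_\<Delta>W n s t \<omega>))\<^sup>2) \<partial>M)
        \<le> (\<integral>\<^sup>+\<omega>. ennreal (2 * (norm (X n t \<omega>))\<^sup>2 + 2 * (norm (X n s \<omega>))\<^sup>2) \<partial>M)"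
      by (intro nn_integral_mono ennreal_leI) (simp add: norm_diff_square_le)
    also have "\<dots> = 2 * N n t + 2 * N n s"
      using assms by (simp add: N_def ennreal_plus ennreal_mult nn_integral_add nn_integral_cmult)
    finally show ?thesis .
  qed
  have "(\<lambda>n. 2 * N n t + 2 * N n s) \<longlonglongrightarrow> 2 * 0 + 2 * 0"
    using assms by (intro tendsto_add ennreal_tendsto_cmult N0) auto
  then have "(\<lambda>n. 2 * N n t + 2 * N n s) \<longlonglongrightarrow> 0" by simp
  then show ?thesis
    by (rule tendsto_sandwich[OF _ _ tendsto_const, rotated 2]) (auto simp: le)
qed

lemma norm_truncated_\<Delta>W:
  "(norm (truncated_\<Delta>W n s t \<omega>))\<^sup>2 = (\<Sum>i<n. (\<Delta>\<beta> i s t \<omega>)\<^sup>2 * (norm (R (e i)))\<^sup>2)"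
proof -
  have "(norm (truncated_\<Delta>W n s t \<omega>))\<^sup>2 = (\<Sum>i<n. \<Sum>j<n. 
      if i = j then (\<Delta>\<beta> i s t \<omega>)\<^sup>2 * (norm (R (e i)))\<^sup>2 else 0)"
    unfolding power2_norm_eq_inner truncated_\<Delta>W_def inner_sum_left inner_sum_right
    by (intro sum.cong refl) (simp add: R_basis_orthogonal power2_norm_eq_inner power2_eq_square)
  then show ?thesis by simp
qed

lemma \<Delta>W_square_integrable:
  assumes "0 \<le> s" "s < t"
  shows "integrable M (\<lambda>\<omega>. (norm (\<Delta>W s t \<omega>))\<^sup>2)"
proof -
  let ?d = "\<lambda>n \<omega>. norm (\<Delta>W s t \<omega> - truncated_\<Delta>W n s t \<omega>)"
  note [measurable] = truncation_error_measurable[OF assms] norm_\<Delta>W_measurable[OF assms]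
  have "\<forall>\<^sub>F n in sequentially. (\<integral>\<^sup>+\<omega>. ennreal ((?d n \<omega>)\<^sup>2) \<partial>M) < \<infinity>"
    using truncation_error_tendsto_0[OF assms] by (intro order_tendstoD(2)) auto
  then obtain n where "(\<integral>\<^sup>+\<omega>. ennreal ((?d n \<omega>)\<^sup>2) \<partial>M) < \<infinity>"
    by (auto simp: eventually_sequentially)
  then have d: "integrable M (\<lambda>\<omega>. (?d n \<omega>)\<^sup>2)"
    by (simp add: integrable_iff_bounded)
  have tr: "integrable M (\<lambda>\<omega>. (norm (truncated_\<Delta>W n s t \<omega>))\<^sup>2)"
    unfolding norm_truncated_\<Delta>W using \<Delta>\<beta>_moments(2)[OF assms] by simp
  show ?thesis
  proof (rule Bochner_Integration.integrable_bound)
    show "integrable M (\<lambda>\<omega>. 2 * (?d n \<omega>)\<^sup>2 + 2 * (norm (truncated_\<Delta>W n s t \<omega>))\<^sup>2)"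
      using d tr by simp
    have "(norm (\<Delta>W s t \<omega>))\<^sup>2 \<le> 2 * (?d n \<omega>)\<^sup>2 + 2 * (norm (truncated_\<Delta>W n s t \<omega>))\<^sup>2" for \<omega>
      using norm_diff_square_le[of "\<Delta>W s t \<omega> - truncated_\<Delta>W n s t \<omega>" "- truncated_\<Delta>W n s t \<omega>"]
      by simp
    then show "AE \<omega> in M. norm ((norm (\<Delta>W s t \<omega>))\<^sup>2)
        \<le> norm (2 * (?d n \<omega>)\<^sup>2 + 2 * (norm (truncated_\<Delta>W n s t \<omega>))\<^sup>2)" by simp
  qed simp
qed

text \<open>A correlation with \<open>\<Delta>W\<close> is determined by the correlations with the scalar Brownian
  increments. Its uses are with \<open>Y\<close> a Brownian increment over the same interval, for the mean square
  of \<open>\<Delta>W\<close>, and over a later interval, for \<open>future_orthogonal_\<Delta>W\<close>.\<close>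

lemma expectation_times_\<Delta>W:
  fixes \<phi> :: "'u \<Rightarrow> real"
  assumes "0 \<le> s" "s < t" and \<phi>: "bounded_linear \<phi>"
    and Y [measurable]: "Y \<in> borel_measurable M" and Y2: "integrable M (\<lambda>\<omega>. (Y \<omega>)\<^sup>2)"
  shows "(\<lambda>n. \<Sum>i<n. \<phi> (R (e i)) * expectation (\<lambda>\<omega>. Y \<omega> * \<Delta>\<beta> i s t \<omega>))
      \<longlonglongrightarrow> expectation (\<lambda>\<omega>. Y \<omega> * \<phi> (\<Delta>W s t \<omega>))"
proof -
  interpret \<phi>: bounded_linear \<phi> by fact
  obtain C where C: "\<And>x. norm (\<phi> x) \<le> norm x * C" "0 < C" using \<phi>.pos_bounded by blast
  have int: "integrable M (\<lambda>\<omega>. Y \<omega> * \<Delta>\<beta> i s t \<omega>)" for i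
    using \<Delta>\<beta>_moments[OF assms(1,2)] Y Y2 by (intro integrable_mult_square_integrable)
  have eq: "Y \<omega> * \<phi> (truncated_\<Delta>W n s t \<omega>) = (\<Sum>i<n. \<phi> (R (e i)) * (Y \<omega> * \<Delta>\<beta> i s t \<omega>))" for n \<omega>
    by (simp add: truncated_\<Delta>W_def \<phi>.sum \<phi>.scaleR sum_distrib_left mult_ac)
  have "(\<lambda>n. expectation (\<lambda>\<omega>. Y \<omega> * \<phi> (truncated_\<Delta>W n s t \<omega>)))
      \<longlonglongrightarrow> expectation (\<lambda>\<omega>. Y \<omega> * \<phi> (\<Delta>W s t \<omega>))"
  proof (rule expectation_tendsto_mean_square(2))
    show "(\<lambda>\<omega>. C * Y \<omega>) \<in> borel_measurable M" by simp
    show "(\<lambda>\<omega>. Y \<omega> * \<phi> (\<Delta>W s t \<omega>)) \<in> borel_measurable M"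
      using \<Delta>W_functional_measurable[OF assms(1-3)] by simp
    show "integrable M (\<lambda>\<omega>. (C * Y \<omega>)\<^sup>2)" using Y2 by (simp add: power_mult_distrib)
    show "integrable M (\<lambda>\<omega>. Y \<omega> * \<phi> (truncated_\<Delta>W n s t \<omega>))" for n
      unfolding eq using int by simp
    show "\<bar>Y \<omega> * \<phi> (\<Delta>W s t \<omega>) - Y \<omega> * \<phi> (truncated_\<Delta>W n s t \<omega>)\<bar>
      \<le> \<bar>C * Y \<omega>\<bar> * \<bar>norm (\<Delta>W s t \<omega> - truncated_\<Delta>W n s t \<omega>)\<bar>" for n \<omega>
    proof -
      have "\<bar>Y \<omega> * \<phi> (\<Delta>W s t \<omega>) - Y \<omega> * \<phi> (truncated_\<Delta>W n s t \<omega>)\<bar>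
        = \<bar>Y \<omega>\<bar> * norm (\<phi> (\<Delta>W s t \<omega> - truncated_\<Delta>W n s t \<omega>))"
        by (simp add: \<phi>.diff right_diff_distrib[symmetric] abs_mult)
      also have "\<dots> \<le> \<bar>Y \<omega>\<bar> * (norm (\<Delta>W s t \<omega> - truncated_\<Delta>W n s t \<omega>) * C)"
        by (intro mult_left_mono C) simp
      finally show ?thesis using C(2) by (simp add: abs_mult mult_ac)
    qed
  qed (use truncation_error_measurable[OF assms(1,2)] truncation_error_tendsto_0[OF assms(1,2)] in auto)
  then show ?thesis unfolding eq using int by simp
qed

text \<open>The Ito isometry over one step. The mixed moment of \<open>\<Delta>W\<close> with its truncation is
  \<open>t - s\<close> times a partial sum of the trace, because the vectors \<open>R (e i)\<close> are pairwise orthogonal.\<close>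

lemma expectation_norm_\<Delta>W:
  assumes "0 \<le> s" "s < t"
  shows "expectation (\<lambda>\<omega>. (norm (\<Delta>W s t \<omega>))\<^sup>2) = (t - s) * op_trace V Q"
proof -
  note b = \<Delta>\<beta>_moments[OF assms]
  have int: "integrable M (\<lambda>\<omega>. \<Delta>\<beta> i s t \<omega> * (\<Delta>W s t \<omega> \<bullet> v))" for i v
  proof (rule integrable_mult_square_integrable)
    show "integrable M (\<lambda>\<omega>. (\<Delta>W s t \<omega> \<bullet> v)\<^sup>2)"
      using assms by (intro integrable_square_bounded_linear[where \<phi> = "\<lambda>u. u \<bullet> v"]
          bounded_linear_inner_left \<Delta>W_square_integrable) simp_all
  qed (use b assms in simp_all)
  \<comment> \<open>Of the series for this correlation only the term with index \<open>i\<close> is nonzero.\<close>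
  have E: "expectation (\<lambda>\<omega>. \<Delta>\<beta> i s t \<omega> * (\<Delta>W s t \<omega> \<bullet> R (e i))) = (t - s) * (norm (R (e i)))\<^sup>2" for i
  proof -
    have "(R (e j) \<bullet> R (e i)) * expectation (\<lambda>\<omega>. \<Delta>\<beta> i s t \<omega> * \<Delta>\<beta> j s t \<omega>)
      = (if i = j then (t - s) * (norm (R (e i)))\<^sup>2 else 0)" for j
      using b(3)[of i] by (auto simp: R_basis_orthogonal power2_eq_square)
    then have "(\<lambda>n. if i < n then (t - s) * (norm (R (e i)))\<^sup>2 else 0)
        \<longlonglongrightarrow> expectation (\<lambda>\<omega>. \<Delta>\<beta> i s t \<omega> * (\<Delta>W s t \<omega> \<bullet> R (e i)))"
      using expectation_times_\<Delta>W[OF assms bounded_linear_inner_left[of "R (e i)"] b(1,2)[of i]] by simp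
    moreover have "(\<lambda>n. if i < n then (t - s) * (norm (R (e i)))\<^sup>2 else 0)
        \<longlonglongrightarrow> (t - s) * (norm (R (e i)))\<^sup>2"
      by (rule tendsto_eventually) (use eventually_gt_at_top[of i] in eventually_elim, simp)
    ultimately show ?thesis by (rule LIMSEQ_unique)
  qed
  have eq: "\<Delta>W s t \<omega> \<bullet> truncated_\<Delta>W n s t \<omega> = (\<Sum>i<n. \<Delta>\<beta> i s t \<omega> * (\<Delta>W s t \<omega> \<bullet> R (e i)))" for n \<omega>
    by (simp add: truncated_\<Delta>W_def inner_sum_right)
  note [measurable] = truncation_error_measurable[OF assms] norm_\<Delta>W_measurable[OF assms]
  have "(\<lambda>n. expectation (\<lambda>\<omega>. \<Delta>W s t \<omega> \<bullet> truncated_\<Delta>W n s t \<omega>))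
      \<longlonglongrightarrow> expectation (\<lambda>\<omega>. (norm (\<Delta>W s t \<omega>))\<^sup>2)"
  proof (rule expectation_tendsto_mean_square(2))
    show "integrable M (\<lambda>\<omega>. \<Delta>W s t \<omega> \<bullet> truncated_\<Delta>W n s t \<omega>)" for n
      unfolding eq using int by simp
    show "\<bar>(norm (\<Delta>W s t \<omega>))\<^sup>2 - \<Delta>W s t \<omega> \<bullet> truncated_\<Delta>W n s t \<omega>\<bar>
      \<le> \<bar>norm (\<Delta>W s t \<omega>)\<bar> * \<bar>norm (\<Delta>W s t \<omega> - truncated_\<Delta>W n s t \<omega>)\<bar>" for n \<omega>
      using Cauchy_Schwarz_ineq2[of "\<Delta>W s t \<omega>" "\<Delta>W s t \<omega> - truncated_\<Delta>W n s t \<omega>"]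
      by (simp add: power2_norm_eq_inner inner_diff_right)
  qed (use \<Delta>W_square_integrable[OF assms] truncation_error_tendsto_0[OF assms] in auto)
  moreover have "expectation (\<lambda>\<omega>. \<Delta>W s t \<omega> \<bullet> truncated_\<Delta>W n s t \<omega>)
      = (t - s) * (\<Sum>i<n. (norm (R (e i)))\<^sup>2)" for n
    unfolding eq using int E by (simp add: sum_distrib_left)
  moreover have "(\<lambda>n. (t - s) * (\<Sum>i<n. (norm (R (e i)))\<^sup>2)) \<longlonglongrightarrow> (t - s) * op_trace V Q"
    using op_trace_eq_Hilbert_Schmidt_norm[OF covariance sqrt_cov eigenbasis(1)]
    by (intro tendsto_intros) (simp add: sums_def)
  ultimately show ?thesis by (auto intro: LIMSEQ_unique)
qed

text \<open>A mean square limit such as \<open>W t\<close> is determined only up to null sets, which \<open>F t\<close> may fail to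
  contain; it agrees almost surely with a variable measurable with respect to \<open>F t\<close> but need not be one
  itself. Orthogonality to all later Brownian increments takes the place of adaptedness, because it is
  linear and closed under mean square limits.\<close>

definition future_orthogonal :: "real \<Rightarrow> ('w \<Rightarrow> real) \<Rightarrow> bool" where
  "future_orthogonal t Y \<longleftrightarrow>
     Y \<in> borel_measurable M \<and> integrable M (\<lambda>\<omega>. (Y \<omega>)\<^sup>2) \<and>
     (\<forall>j s s'. t \<le> s \<and> s < s' \<longrightarrow> expectation (\<lambda>\<omega>. Y \<omega> * \<Delta>\<beta> j s s' \<omega>) = 0)"

lemma future_orthogonal_cong:
  assumes "\<And>\<omega>. \<omega> \<in> space M \<Longrightarrow> X \<omega> = Y \<omega>"
  shows "future_orthogonal t X \<longleftrightarrow> future_orthogonal t Y"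
  unfolding future_orthogonal_def using assms
  by (simp cong: measurable_cong Bochner_Integration.integrable_cong Bochner_Integration.integral_cong)

lemma future_orthogonal_mono: "future_orthogonal s Y \<Longrightarrow> s \<le> t \<Longrightarrow> future_orthogonal t Y"
  by (auto simp: future_orthogonal_def)

lemma future_orthogonal_add:
  assumes "0 \<le> t" "future_orthogonal t X" "future_orthogonal t Y"
  shows "future_orthogonal t (\<lambda>\<omega>. X \<omega> + Y \<omega>)"
proof -
  have [measurable]: "X \<in> borel_measurable M" "Y \<in> borel_measurable M"
    and X: "integrable M (\<lambda>\<omega>. (X \<omega>)\<^sup>2)" and Y: "integrable M (\<lambda>\<omega>. (Y \<omega>)\<^sup>2)"
    using assms by (auto simp: future_orthogonal_def)
  have "integrable M (\<lambda>\<omega>. (X \<omega>)\<^sup>2 + (Y \<omega>)\<^sup>2 + 2 * (X \<omega> * Y \<omega>))"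
    using X Y integrable_mult_square_integrable[OF _ _ X Y] by simp
  then have "integrable M (\<lambda>\<omega>. (X \<omega> + Y \<omega>)\<^sup>2)"
    by (simp add: power2_sum mult_ac)
  moreover have "expectation (\<lambda>\<omega>. (X \<omega> + Y \<omega>) * \<Delta>\<beta> j s s' \<omega>) = 0" if "t \<le> s" "s < s'" for j s s'
  proof -
    have "0 \<le> s" using assms(1) that by simp
    note b = \<Delta>\<beta>_moments[OF this that(2), of j]
    show ?thesis
      using assms(2,3) that integrable_mult_square_integrable[OF _ b(1) X b(2)]
        integrable_mult_square_integrable[OF _ b(1) Y b(2)]
      by (simp add: future_orthogonal_def distrib_right)
  qed
  ultimately show ?thesis by (simp add: future_orthogonal_def)
qed

lemma future_orthogonal_adapted:
  assumes "0 \<le> t" and Y: "Y \<in> borel_measurable (F t)" "integrable M (\<lambda>\<omega>. (Y \<omega>)\<^sup>2)"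
  shows "future_orthogonal t Y"
  unfolding future_orthogonal_def
proof (intro conjI allI impI)
  show meas: "Y \<in> borel_measurable M"
    using F_measurable_imp_measurable[OF Y(1) assms(1)] .
  have "integrable M (\<lambda>\<omega>. Y \<omega> * 1)"
    using meas Y(2) by (intro integrable_mult_square_integrable) simp_all
  then have int: "integrable M Y" by simp
  fix j s s' assume s: "t \<le> s \<and> s < s'"
  have "Y \<in> borel_measurable (F s)"
    using F_measurable_mono[OF Y(1) assms(1)] s by blast
  then show "expectation (\<lambda>\<omega>. Y \<omega> * \<Delta>\<beta> j s s' \<omega>) = 0"
    unfolding \<Delta>\<beta>_def using s assms(1)
    by (intro brownian_increment_orthogonal_past[OF prob_space_axioms basis brownian _ _ _ int]) auto
qed (rule Y(2))

lemma future_orthogonal_\<Delta>W: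
  fixes \<phi> :: "'u \<Rightarrow> real"
  assumes "0 \<le> s" "s < t" and \<phi>: "bounded_linear \<phi>"
  shows "future_orthogonal t (\<lambda>\<omega>. \<phi> (\<Delta>W s t \<omega>))"
  unfolding future_orthogonal_def
proof (intro conjI allI impI)
  show meas: "(\<lambda>\<omega>. \<phi> (\<Delta>W s t \<omega>)) \<in> borel_measurable M"
    by (rule \<Delta>W_functional_measurable[OF assms])
  show "integrable M (\<lambda>\<omega>. (\<phi> (\<Delta>W s t \<omega>))\<^sup>2)"
    by (rule integrable_square_bounded_linear[OF \<phi> meas \<Delta>W_square_integrable[OF assms(1,2)]])
  fix j s' t' assume t: "t \<le> s' \<and> s' < t'"
  have "future_orthogonal t (\<Delta>\<beta> i s t)" for i
  proof (rule future_orthogonal_adapted)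
    show "\<Delta>\<beta> i s t \<in> borel_measurable (F t)"
      unfolding \<Delta>\<beta>_def[abs_def] using assms
      by (intro borel_measurable_diff \<beta>_adapted F_measurable_mono[OF \<beta>_adapted, of s]) simp_all
  qed (use assms \<Delta>\<beta>_moments[OF assms(1,2)] in auto)
  then have "expectation (\<lambda>\<omega>. \<Delta>\<beta> j s' t' \<omega> * \<Delta>\<beta> i s t \<omega>) = 0" for i
    using t by (auto simp: future_orthogonal_def mult.commute)
  moreover have "0 \<le> s'" "s' < t'" using assms t by auto
  ultimately show "expectation (\<lambda>\<omega>. \<phi> (\<Delta>W s t \<omega>) * \<Delta>\<beta> j s' t' \<omega>) = 0"
    using expectation_times_\<Delta>W[OF assms, of "\<Delta>\<beta> j s' t'"] \<Delta>\<beta>_moments[of s' t' j]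
    by (simp add: LIMSEQ_const_iff mult.commute)
qed

text \<open>The martingale property of the noise: a state whose coordinates are orthogonal to the
  future is uncorrelated with the next increment.\<close>

lemma state_orthogonal_\<Delta>W:
  fixes Z :: "'w \<Rightarrow> 'h::real_inner" and G :: "'u \<Rightarrow> 'h"
  assumes "0 \<le> s" "s < t" and G: "bounded_linear G"
    and Z2: "integrable M (\<lambda>\<omega>. (norm (Z \<omega>))\<^sup>2)"
    and Z: "\<And>v. v \<in> V \<Longrightarrow> future_orthogonal s (\<lambda>\<omega>. Z \<omega> \<bullet> G v)"
  shows "integrable M (\<lambda>\<omega>. Z \<omega> \<bullet> G (\<Delta>W s t \<omega>))"
    and "expectation (\<lambda>\<omega>. Z \<omega> \<bullet> G (\<Delta>W s t \<omega>)) = 0"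
proof -
  interpret G: bounded_linear G by fact
  obtain C where C: "\<And>x. norm (G x) \<le> norm x * C" "0 < C" using G.pos_bounded by blast
  have [measurable]: "(\<lambda>\<omega>. norm (Z \<omega>)) \<in> borel_measurable M"
    using measurable_compose[OF borel_measurable_integrable[OF Z2] borel_measurable_sqrt] by simp
  have Zmeas: "(\<lambda>\<omega>. Z \<omega> \<bullet> G v) \<in> borel_measurable M" if "v \<in> V" for v
    using Z[OF that] by (simp add: future_orthogonal_def)
  note eV = orthonormal_basis_subspace(2)[OF eigenbasis(1)]
  \<comment> \<open>Both factors are random vectors; expanding \<open>\<Delta>W\<close> in the basis reduces their inner product to
    sums of products of coordinates.\<close>
  have meas: "(\<lambda>\<omega>. Z \<omega> \<bullet> G (\<Delta>W s t \<omega>)) \<in> borel_measurable M"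
  proof (rule borel_measurable_LIMSEQ_real)
    show "(\<lambda>n. Z \<omega> \<bullet> G (partial_expansion e n (\<Delta>W s t \<omega>))) \<longlonglongrightarrow> Z \<omega> \<bullet> G (\<Delta>W s t \<omega>)"
      if "\<omega> \<in> space M" for \<omega>
      by (intro tendsto_intros G.tendsto partial_expansion_tendsto[OF eigenbasis(1)]
          \<Delta>W_in_V assms(1,2) that)
    show "(\<lambda>\<omega>. Z \<omega> \<bullet> G (partial_expansion e n (\<Delta>W s t \<omega>))) \<in> borel_measurable M" for n
      unfolding partial_expansion_def G.sum G.scaleR inner_sum_right inner_scaleR_right
      using assms(1,2) Zmeas[OF eV] by simp
  qed
  have eq: "Z \<omega> \<bullet> G (truncated_\<Delta>W n s t \<omega>) = (\<Sum>i<n. (Z \<omega> \<bullet> G (R (e i))) * \<Delta>\<beta> i s t \<omega>)" for n \<omega>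
    by (simp add: truncated_\<Delta>W_def G.sum G.scaleR inner_sum_right mult.commute)
  have int: "integrable M (\<lambda>\<omega>. (Z \<omega> \<bullet> G (R (e i))) * \<Delta>\<beta> i s t \<omega>)" for i
    using Z[OF R_in_V, of i] \<Delta>\<beta>_moments[OF assms(1,2)]
    by (intro integrable_mult_square_integrable) (auto simp: future_orthogonal_def)
  have 0: "expectation (\<lambda>\<omega>. Z \<omega> \<bullet> G (truncated_\<Delta>W n s t \<omega>)) = 0" for n
    unfolding eq using int Z[OF R_in_V] assms(2) by (simp add: future_orthogonal_def)
  have a: "(\<lambda>\<omega>. C * norm (Z \<omega>)) \<in> borel_measurable M" "integrable M (\<lambda>\<omega>. (C * norm (Z \<omega>))\<^sup>2)"
    using Z2 by (simp_all add: power_mult_distrib)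
  have int': "integrable M (\<lambda>\<omega>. Z \<omega> \<bullet> G (truncated_\<Delta>W n s t \<omega>))" for n
    unfolding eq using int by simp
  have bound: "\<bar>Z \<omega> \<bullet> G (\<Delta>W s t \<omega>) - Z \<omega> \<bullet> G (truncated_\<Delta>W n s t \<omega>)\<bar>
      \<le> \<bar>C * norm (Z \<omega>)\<bar> * \<bar>norm (\<Delta>W s t \<omega> - truncated_\<Delta>W n s t \<omega>)\<bar>" for n \<omega>
  proof -
    have "\<bar>Z \<omega> \<bullet> G (\<Delta>W s t \<omega> - truncated_\<Delta>W n s t \<omega>)\<bar>
        \<le> norm (Z \<omega>) * norm (G (\<Delta>W s t \<omega> - truncated_\<Delta>W n s t \<omega>))"
      by (rule Cauchy_Schwarz_ineq2)
    also have "\<dots> \<le> norm (Z \<omega>) * (norm (\<Delta>W s t \<omega> - truncated_\<Delta>W n s t \<omega>) * C)"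
      by (intro mult_left_mono C) simp
    finally show ?thesis using C(2) by (simp add: G.diff inner_diff_right abs_mult mult_ac)
  qed
  note lim = expectation_tendsto_mean_square[OF a(1) meas truncation_error_measurable[OF assms(1,2)]
      a(2) int' truncation_error_tendsto_0[OF assms(1,2)] bound]
  show "integrable M (\<lambda>\<omega>. Z \<omega> \<bullet> G (\<Delta>W s t \<omega>))" by (rule lim(1))
  show "expectation (\<lambda>\<omega>. Z \<omega> \<bullet> G (\<Delta>W s t \<omega>)) = 0"
    using lim(2) by (simp add: 0 LIMSEQ_const_iff)
qed

end

lemma unitary_on_inner_preimage:
  assumes "unitary_on H T" "v \<in> H"
  obtains v' where "v' \<in> H" "\<And>x. x \<in> H \<Longrightarrow> T x \<bullet> v = x \<bullet> v'"
  using assms unfolding unitary_on_def by (metis imageE)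

section \<open>The energy law of the exponential integrator\<close>

context wiener_process
begin

text \<open>Unitarity enters twice: it preserves the norm, and its surjectivity turns a coordinate of the
  new state along \<open>v\<close> into a coordinate of \<open>Z k \<omega> + G (\<Delta>W s t \<omega>)\<close> along the preimage of \<open>v\<close>. The
  conjuncts on membership, orthogonality to the future and integrability are what the induction
  needs: additivity of \<open>S h\<close> holds on \<open>H\<close> only, and the other two make the cross term in the new
  squared norm vanish in expectation.\<close>

lemma exp_integrator_energy:
  fixes H :: "'h::real_inner set" and S :: "real \<Rightarrow> 'h \<Rightarrow> 'h" and G :: "'u \<Rightarrow> 'h"
    and Z0 :: "'w \<Rightarrow> 'h" and c h :: real
  assumes H: "subspace H" and S: "unitary_on H (S h)"
    and G: "bounded_linear G" "\<And>u. u \<in> V \<Longrightarrow> G u \<in> H"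
      "\<And>u. u \<in> V \<Longrightarrow> (norm (G u))\<^sup>2 = c * (norm u)\<^sup>2"
    and h: "0 < h"
    and Z0: "\<And>\<omega>. \<omega> \<in> space M \<Longrightarrow> Z0 \<omega> \<in> H"
      "\<And>v. v \<in> H \<Longrightarrow> future_orthogonal 0 (\<lambda>\<omega>. Z0 \<omega> \<bullet> v)"
      "integrable M (\<lambda>\<omega>. (norm (Z0 \<omega>))\<^sup>2)"
  defines "Z \<equiv> exp_integrator S G W h Z0"
  shows "(\<forall>\<omega>\<in>space M. Z k \<omega> \<in> H) \<and>
    (\<forall>v\<in>H. future_orthogonal (real k * h) (\<lambda>\<omega>. Z k \<omega> \<bullet> v)) \<and>
    integrable M (\<lambda>\<omega>. (norm (Z k \<omega>))\<^sup>2) \<and>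
    expectation (\<lambda>\<omega>. (norm (Z k \<omega>))\<^sup>2) =
      expectation (\<lambda>\<omega>. (norm (Z0 \<omega>))\<^sup>2) + c * op_trace V Q * (real k * h)"
proof (induction k)
  case 0
  then show ?case using Z0 by (simp add: Z_def)
next
  case (Suc k)
  define s where "s = real k * h"
  define t where "t = real (Suc k) * h"
  have st: "0 \<le> s" "s < t" "t - s = h" using h by (auto simp: s_def t_def algebra_simps)
  have ZH: "Z k \<omega> \<in> H" if "\<omega> \<in> space M" for \<omega> using Suc that by simp
  have ZF: "future_orthogonal s (\<lambda>\<omega>. Z k \<omega> \<bullet> v)" if "v \<in> H" for v
    using Suc that by (simp add: s_def)
  have Zint: "integrable M (\<lambda>\<omega>. (norm (Z k \<omega>))\<^sup>2)" using Suc by simp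
  have WV: "\<Delta>W s t \<omega> \<in> V" if "\<omega> \<in> space M" for \<omega>
    using \<Delta>W_in_V[OF st(1,2) that] .
  have step: "Z (Suc k) \<omega> = S h (Z k \<omega> + G (\<Delta>W s t \<omega>))" if "\<omega> \<in> space M" for \<omega>
    using S ZH[OF that] G(2)[OF WV[OF that]]
    by (simp add: Z_def s_def t_def \<Delta>W_def unitary_on_def bounded_linear_on_def)
  have sumH: "Z k \<omega> + G (\<Delta>W s t \<omega>) \<in> H" if "\<omega> \<in> space M" for \<omega>
    by (intro subspace_add H ZH G WV that)
  have inH: "Z (Suc k) \<omega> \<in> H" if "\<omega> \<in> space M" for \<omega>
    using S sumH[OF that] step[OF that] by (auto simp: unitary_on_def)
  have fut: "future_orthogonal t (\<lambda>\<omega>. Z (Suc k) \<omega> \<bullet> v)" if v: "v \<in> H" for v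
  proof -
    obtain v' where v': "v' \<in> H" "\<And>x. x \<in> H \<Longrightarrow> S h x \<bullet> v = x \<bullet> v'"
      using unitary_on_inner_preimage[OF S v] by blast
    have "bounded_linear (\<lambda>u. G u \<bullet> v')"
      using bounded_linear_compose[OF bounded_linear_inner_left G(1)] .
    then have "future_orthogonal t (\<lambda>\<omega>. Z k \<omega> \<bullet> v' + G (\<Delta>W s t \<omega>) \<bullet> v')"
      using st ZF[OF v'(1)]
      by (intro future_orthogonal_add future_orthogonal_\<Delta>W future_orthogonal_mono[of s _ t])
        simp_all
    moreover have "Z (Suc k) \<omega> \<bullet> v = Z k \<omega> \<bullet> v' + G (\<Delta>W s t \<omega>) \<bullet> v'" if "\<omega> \<in> space M" for \<omega>
      using v'(2)[OF sumH[OF that]] by (simp add: step[OF that] inner_add_left)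
    ultimately show ?thesis by (subst future_orthogonal_cong) auto
  qed
  have split: "(norm (Z (Suc k) \<omega>))\<^sup>2
      = (norm (Z k \<omega>))\<^sup>2 + 2 * (Z k \<omega> \<bullet> G (\<Delta>W s t \<omega>)) + c * (norm (\<Delta>W s t \<omega>))\<^sup>2"
    if "\<omega> \<in> space M" for \<omega>
  proof -
    have "(norm (Z (Suc k) \<omega>))\<^sup>2 = (norm (Z k \<omega> + G (\<Delta>W s t \<omega>)))\<^sup>2"
      using S sumH[OF that] by (simp add: step[OF that] power2_norm_eq_inner unitary_on_def)
    also have "\<dots> = (norm (Z k \<omega>))\<^sup>2 + 2 * (Z k \<omega> \<bullet> G (\<Delta>W s t \<omega>)) + (norm (G (\<Delta>W s t \<omega>)))\<^sup>2"
      by (simp add: power2_norm_eq_inner inner_simps inner_commute)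
    finally show ?thesis by (simp add: G(3)[OF WV[OF that]])
  qed
  note cross = state_orthogonal_\<Delta>W[OF st(1,2) G(1) Zint ZF[OF G(2)]]
  note dW = \<Delta>W_square_integrable[OF st(1,2)] expectation_norm_\<Delta>W[OF st(1,2)]
  have int: "integrable M (\<lambda>\<omega>. (norm (Z (Suc k) \<omega>))\<^sup>2)"
    using Zint cross(1) dW(1)
    by (subst Bochner_Integration.integrable_cong[OF refl split]) simp_all
  have "expectation (\<lambda>\<omega>. (norm (Z (Suc k) \<omega>))\<^sup>2)
      = expectation (\<lambda>\<omega>. (norm (Z k \<omega>))\<^sup>2 + 2 * (Z k \<omega> \<bullet> G (\<Delta>W s t \<omega>)) + c * (norm (\<Delta>W s t \<omega>))\<^sup>2)"
    by (rule Bochner_Integration.integral_cong[OF refl split])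
  also have "\<dots> = expectation (\<lambda>\<omega>. (norm (Z k \<omega>))\<^sup>2) + c * ((t - s) * op_trace V Q)"
    using Zint cross dW by simp
  also have "\<dots> = expectation (\<lambda>\<omega>. (norm (Z0 \<omega>))\<^sup>2) + c * op_trace V Q * t"
    using Suc by (simp add: s_def t_def algebra_simps)
  finally show ?case using inH fut int unfolding t_def by blast
qed

end

section \<open>Fields on the domain\<close>

lemma rep_L2_square_integrable: "square_integrable (rep_L2 u)"
  using Quotient3_rep_reflp[OF Quotient3_L2, of u] by simp

lemma rep_abs_L2_AE:
  assumes "square_integrable f"
  shows "AE x in lborel. rep_L2 (abs_L2 f) x = f x"
  using rep_abs_rsp[OF Quotient3_L2, of f f] assms by (auto elim: eventually_mono)

lemma rep_L2_linear_AE: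
  fixes u v :: "'a::euclidean_space L2"
  shows "AE x in lborel. rep_L2 (0 :: 'a L2) x = 0"
  "AE x in lborel. rep_L2 (u + v) x = rep_L2 u x + rep_L2 v x"
  "AE x in lborel. rep_L2 (c *\<^sub>R u) x = c *\<^sub>R rep_L2 u x"
  "AE x in lborel. rep_L2 (times_ones w) x = rep_L2 w x *\<^sub>R (\<chi> i. 1)"
  unfolding zero_L2_def plus_L2_def scaleR_L2_def times_ones_def map_fun_def comp_def id_def
  by (intro rep_abs_L2_AE square_integrable_zero square_integrable_add square_integrable_scaleR
      square_integrable_times_const rep_L2_square_integrable)+

lemma subspace_L2_on: "subspace (L2_on D :: 'a::euclidean_space L2 set)"
  unfolding subspace_def L2_on_def
proof (intro conjI ballI allI CollectI)
  show "AE x in lborel. x \<notin> D \<longrightarrow> rep_L2 (0 :: 'a L2) x = 0"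
    using rep_L2_linear_AE(1)[where 'a = 'a] by eventually_elim simp
next
  fix u v :: "'a L2"
  assume "u \<in> {u. AE x in lborel. x \<notin> D \<longrightarrow> rep_L2 u x = 0}"
    "v \<in> {u. AE x in lborel. x \<notin> D \<longrightarrow> rep_L2 u x = 0}"
  then have "AE x in lborel. x \<notin> D \<longrightarrow> rep_L2 u x = 0" "AE x in lborel. x \<notin> D \<longrightarrow> rep_L2 v x = 0"
    by simp_all
  then show "AE x in lborel. x \<notin> D \<longrightarrow> rep_L2 (u + v) x = 0"
    using rep_L2_linear_AE(2)[of u v] by eventually_elim simp
next
  fix u :: "'a L2" and c
  assume "u \<in> {u. AE x in lborel. x \<notin> D \<longrightarrow> rep_L2 u x = 0}"
  then have "AE x in lborel. x \<notin> D \<longrightarrow> rep_L2 u x = 0" by simp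
  then show "AE x in lborel. x \<notin> D \<longrightarrow> rep_L2 (c *\<^sub>R u) x = 0"
    using rep_L2_linear_AE(3)[of c u] by eventually_elim simp
qed

lemma norm_L2_square: "(norm u)\<^sup>2 = (\<integral>x. (norm (rep_L2 u x))\<^sup>2 \<partial>lborel)"
  by (simp add: power2_norm_eq_inner inner_L2_def)

text \<open>The norm integrates over the whole space and the energy over \<open>D\<close> only; elements of
  \<open>em_space D\<close> vanish almost everywhere outside \<open>D\<close>.\<close>

lemma energy_eq_norm_square:
  assumes "open D" "u \<in> em_space D"
  shows "energy D u = (norm u)\<^sup>2"
proof -
  have int: "integrable lborel (\<lambda>x. (norm (rep_L2 w x))\<^sup>2)" for w :: "(real^3) L2"
    using rep_L2_square_integrable[of w] by (simp add: square_integrable_def)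
  have [measurable]: "rep_L2 w \<in> borel_measurable lborel" for w :: "(real^3) L2"
    using rep_L2_square_integrable[of w] by (simp add: square_integrable_def)
  have [measurable]: "D \<in> sets lborel" using assms(1) by simp
  have "AE x in lborel. x \<notin> D \<longrightarrow> rep_L2 (fst u) x = 0" "AE x in lborel. x \<notin> D \<longrightarrow> rep_L2 (snd u) x = 0"
    using assms(2) by (auto simp: em_space_def L2_on_def)
  then have "AE x in lborel. indicator D x *\<^sub>R ((norm (rep_L2 (fst u) x))\<^sup>2 + (norm (rep_L2 (snd u) x))\<^sup>2)
      = (norm (rep_L2 (fst u) x))\<^sup>2 + (norm (rep_L2 (snd u) x))\<^sup>2"
    by eventually_elim (auto simp: indicator_def)
  then have "energy D u = (\<integral>x. (norm (rep_L2 (fst u) x))\<^sup>2 + (norm (rep_L2 (snd u) x))\<^sup>2 \<partial>lborel)"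
    unfolding energy_def set_lebesgue_integral_def by (intro integral_cong_AE) simp_all
  also have "\<dots> = (norm (fst u))\<^sup>2 + (norm (snd u))\<^sup>2"
    using int by (simp add: norm_L2_square)
  finally show ?thesis by (simp add: norm_prod_def)
qed

lemma L2_eqI:
  assumes "AE x in lborel. rep_L2 u x = rep_L2 v x"
  shows "u = v"
  using Quotient3_rel_rep[OF Quotient3_L2, of u v] assms rep_L2_square_integrable by blast

lemma times_ones_linear:
  "times_ones (u + v) = times_ones u + times_ones v"
  "times_ones (c *\<^sub>R u) = c *\<^sub>R times_ones u"
proof -
  show "times_ones (u + v) = times_ones u + times_ones v"
    using rep_L2_linear_AE(4)[of "u + v"] rep_L2_linear_AE(4)[of u] rep_L2_linear_AE(4)[of v]
      rep_L2_linear_AE(2)[of u v] rep_L2_linear_AE(2)[of "times_ones u" "times_ones v"]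
    by (intro L2_eqI, eventually_elim) (simp add: scaleR_add_left)
  show "times_ones (c *\<^sub>R u) = c *\<^sub>R times_ones u"
    using rep_L2_linear_AE(4)[of "c *\<^sub>R u"] rep_L2_linear_AE(4)[of u]
      rep_L2_linear_AE(3)[of c u] rep_L2_linear_AE(3)[of c "times_ones u"]
    by (intro L2_eqI, eventually_elim) simp
qed

text \<open>The constant \<open>3\<close> is the squared length of the vector \<open>(1, 1, 1)\<close>.\<close>

lemma norm_times_ones: "(norm (times_ones u))\<^sup>2 = 3 * (norm u)\<^sup>2"
proof -
  have "(norm (times_ones u))\<^sup>2 = (\<integral>x. 3 * (norm (rep_L2 u x))\<^sup>2 \<partial>lborel)"
    unfolding norm_L2_square
  proof (rule integral_cong_AE)
    have [measurable]: "rep_L2 u \<in> borel_measurable lborel"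
      "rep_L2 (times_ones u) \<in> borel_measurable lborel"
      using rep_L2_square_integrable[of u] rep_L2_square_integrable[of "times_ones u"]
      by (simp_all add: square_integrable_def)
    show "(\<lambda>x. (norm (rep_L2 (times_ones u) x))\<^sup>2) \<in> borel_measurable lborel"
      "(\<lambda>x. 3 * (norm (rep_L2 u x))\<^sup>2) \<in> borel_measurable lborel" by simp_all
    have ones: "(norm ((\<chi> i. 1) :: real^3))\<^sup>2 = 3"
      by (simp add: power2_norm_eq_inner inner_vec_def)
    show "AE x in lborel. (norm (rep_L2 (times_ones u) x))\<^sup>2 = 3 * (norm (rep_L2 u x))\<^sup>2"
      using rep_L2_linear_AE(4)[of u] by eventually_elim (simp add: power_mult_distrib ones)
  qed
  then show ?thesis by (simp add: norm_L2_square)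
qed

lemma norm_noise_op: "(norm (noise_op l1 l2 u))\<^sup>2 = 3 * (l1\<^sup>2 + l2\<^sup>2) * (norm u)\<^sup>2"
  by (simp add: noise_op_def norm_prod_def power_mult_distrib norm_times_ones algebra_simps)

lemma bounded_linear_noise_op: "bounded_linear (noise_op l1 l2)"
proof (rule bounded_linear_intro)
  show "norm (noise_op l1 l2 u) \<le> norm u * sqrt (3 * (l1\<^sup>2 + l2\<^sup>2))" for u
    using arg_cong[OF norm_noise_op[of l1 l2 u], of sqrt]
    by (simp add: real_sqrt_mult mult.commute)
qed (simp_all add: noise_op_def times_ones_linear scaleR_add_right)

lemma noise_op_in_em_space:
  assumes "u \<in> L2_on D"
  shows "noise_op l1 l2 u \<in> em_space D"
proof -
  have "AE x in lborel. x \<notin> D \<longrightarrow> rep_L2 u x = 0" using assms by (simp add: L2_on_def)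
  then have "times_ones u \<in> L2_on D"
    unfolding L2_on_def mem_Collect_eq using rep_L2_linear_AE(4)[of u] by eventually_elim simp
  then show ?thesis
    by (simp add: noise_op_def em_space_def subspace_scale[OF subspace_L2_on])
qed

lemma maxwell_dom_subset: "maxwell_dom D \<subseteq> em_space D"
  by (auto simp: maxwell_dom_def em_space_def H0_curl_def H_curl_def)

section \<open>The trace formula\<close>

theorem proposition4p1:
  fixes D :: "(real^3) set"
    and S :: "real \<Rightarrow> em_field \<Rightarrow> em_field"
    and M :: "'w measure" and F :: "real \<Rightarrow> 'w measure"
    and Q Qh :: "real L2 \<Rightarrow> real L2"
    and e :: "nat \<Rightarrow> real L2" and \<eta> :: "nat \<Rightarrow> real"
    and \<beta> :: "nat \<Rightarrow> real \<Rightarrow> 'w \<Rightarrow> real" and W :: "real \<Rightarrow> 'w \<Rightarrow> real L2"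
    and U0 :: "'w \<Rightarrow> em_field" and U :: "nat \<Rightarrow> 'w \<Rightarrow> em_field"
    and l1 l2 \<Delta>t K :: real
    and \<Phi> :: "nat \<Rightarrow> 'w \<Rightarrow> real"
  assumes domain: "smooth_bounded_domain D" "simply_connected D"
    and group: "unitary_C0_group_generated_by (em_space D) (maxwell_dom D) (maxwell D) S"
    and basis: "stochastic_basis M F"
    and covariance: "nonneg_trace_class_on (L2_on D) Q"
    and eigenbasis: "orthonormal_basis (L2_on D) e" "\<And>k. Q (e k) = \<eta> k *\<^sub>R e k"
    and sqrt: "is_sqrt_on (L2_on D) Qh Q"
    and brownian: "\<And>k. brownian_motion M F (\<beta> k)" "independent_processes M \<beta>"
    and wiener: "wiener_series M (L2_on D) Qh e \<beta> W"
    and initial_dom: "\<And>\<omega>. \<omega> \<in> space M \<Longrightarrow> U0 \<omega> \<in> maxwell_dom D"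
    and initial_meas: "(\<lambda>\<omega>. (U0 \<omega>, maxwell D (U0 \<omega>))) \<in> borel_measurable (F 0)"
    and initial_moments: "\<And>p::real. p \<ge> 1 \<Longrightarrow>
          integrable M (\<lambda>\<omega>. graph_norm (maxwell D) (U0 \<omega>) powr p)"
    and step: "\<Delta>t > 0"
  defines "U \<equiv> exp_integrator S (noise_op l1 l2) W \<Delta>t U0"
    and "\<Phi> \<equiv> \<lambda>k \<omega>. energy D (U k \<omega>)"
    and "K \<equiv> 3 * (l1\<^sup>2 + l2\<^sup>2) * op_trace (L2_on D) Q"
  shows "\<forall>k\<ge>1. integrable M (\<Phi> 0) \<and> integrable M (\<Phi> k) \<and>
           prob_space.expectation M (\<Phi> k) =
             prob_space.expectation M (\<Phi> 0) + K * (real k * \<Delta>t)"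
proof -
  have "open D" using domain(1) by (simp add: smooth_bounded_domain_def)
  interpret wiener_process M F "L2_on D" Q Qh e \<eta> \<beta> W
    by unfold_locales (fact basis covariance eigenbasis sqrt brownian wiener)+
  have U0_in: "U0 \<omega> \<in> em_space D" if "\<omega> \<in> space M" for \<omega>
    using initial_dom[OF that] maxwell_dom_subset by blast
  have U0_meas: "U0 \<in> borel_measurable (F 0)"
    using measurable_compose[OF initial_meas borel_measurable_continuous_onI[OF continuous_on_fst[OF continuous_on_id]]]
    by simp
  have U0_meas': "(\<lambda>\<omega>. U0 \<omega> \<bullet> v) \<in> borel_measurable (F 0)" for v
    by (rule borel_measurable_bounded_linear[OF bounded_linear_inner_left U0_meas])
  have U0_int: "integrable M (\<lambda>\<omega>. (norm (U0 \<omega>))\<^sup>2)"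
  proof (rule Bochner_Integration.integrable_bound)
    show "integrable M (\<lambda>\<omega>. graph_norm (maxwell D) (U0 \<omega>) powr 2)"
      using initial_moments[of 2] by simp
    \<comment> \<open>The graph norm dominates the norm, so its second moment controls the initial energy.\<close>
    have "(norm (U0 \<omega>))\<^sup>2 \<le> graph_norm (maxwell D) (U0 \<omega>) powr 2" for \<omega>
      by (simp add: graph_norm_def)
    then show "AE \<omega> in M. norm ((norm (U0 \<omega>))\<^sup>2) \<le> norm (graph_norm (maxwell D) (U0 \<omega>) powr 2)"
      by simp
    have "U0 \<in> borel_measurable M"
      using U0_meas basis by (intro measurable_from_subalg[of M "F 0"]) (auto simp: stochastic_basis_def)
    then show "(\<lambda>\<omega>. (norm (U0 \<omega>))\<^sup>2) \<in> borel_measurable M"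
      by measurable
  qed
  have law: "(\<forall>\<omega>\<in>space M. U k \<omega> \<in> em_space D) \<and>
    integrable M (\<lambda>\<omega>. (norm (U k \<omega>))\<^sup>2) \<and>
    expectation (\<lambda>\<omega>. (norm (U k \<omega>))\<^sup>2) =
      expectation (\<lambda>\<omega>. (norm (U0 \<omega>))\<^sup>2) + K * (real k * \<Delta>t)" for k
  proof -
    have "subspace (em_space D)"
      unfolding em_space_def by (intro subspace_Times subspace_L2_on)
    moreover have "unitary_on (em_space D) (S \<Delta>t)"
      using group by (simp add: unitary_C0_group_generated_by_def)
    moreover have "future_orthogonal 0 (\<lambda>\<omega>. U0 \<omega> \<bullet> v)" for v
      by (intro future_orthogonal_adapted U0_meas' order_refl
          integrable_square_bounded_linear[OF bounded_linear_inner_left _ U0_int]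
          F_measurable_imp_measurable[OF U0_meas'])
    ultimately show ?thesis
      using exp_integrator_energy[of "em_space D" S \<Delta>t "noise_op l1 l2" "3 * (l1\<^sup>2 + l2\<^sup>2)" U0 k]
        bounded_linear_noise_op noise_op_in_em_space norm_noise_op step U0_in U0_int
      unfolding U_def K_def by blast
  qed
  have \<Phi>: "\<Phi> k \<omega> = (norm (U k \<omega>))\<^sup>2" if "\<omega> \<in> space M" for k \<omega>
    using law[of k] that energy_eq_norm_square[OF \<open>open D\<close>] by (simp add: \<Phi>_def)
  have int: "integrable M (\<Phi> k)" for k
    using law[of k] by (subst Bochner_Integration.integrable_cong[OF refl \<Phi>]) auto
  have E: "expectation (\<Phi> k) = expectation (\<lambda>\<omega>. (norm (U k \<omega>))\<^sup>2)" for k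
    by (rule Bochner_Integration.integral_cong[OF refl \<Phi>])
  show ?thesis
    using law law[of 0] int by (simp add: E)
qed

end
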